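(* Let $R$ be a semi-local ring (i.e. $R/J(R)$ is semisimple artinian). Then the following are equivalent: (i) $R$ is a GWNC ring; (ii) either $R$ is a local ring with nil Jacobson radical, or $R/J(R)\cong {\rm M}_2(\mathbb{Z}_3)$ and $J(R)$ is nil, or $R/J(R)\cong \mathbb{Z}_3\times\mathbb{Z}_3$ and $J(R)$ is nil, or $R$ is a weakly nil-clean ring.
   Context: All rings are associative with identity; $J(R)$ is the Jacobson radical. For a ring $S$, $U(S)$, ${\rm Nil}(S)$, ${\rm Id}(S)$ denote units, nilpotents, idempotents. $S$ is GWNC if every $a\in S\setminus U(S)$ can be written as $a=q+e$ or $a=q-e$ with $q\in{\rm Nil}(S)$, $e\in{\rm Id}(S)$. $S$ is weakly nil-clean if for every $a\in S$ there is $e\in{\rm Id}(S)$ with $a-e$ or $a+e$ nilpotent. A ring is local if $R/J(R)$ is a division ring. *)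

theory Defs
  imports "HOL-Analysis.Analysis" "HOL-Library.Numeral_Type"
begin

definition is_unit :: "'a::ring_1 \<Rightarrow> bool" where
  "is_unit x \<longleftrightarrow> (\<exists>y. x * y = 1 \<and> y * x = 1)"

definition nilp :: "'a::ring_1 \<Rightarrow> bool" where
  "nilp x \<longleftrightarrow> (\<exists>n::nat. x ^ n = 0)"

definition idem :: "'a::ring_1 \<Rightarrow> bool" where
  "idem e \<longleftrightarrow> e * e = e"

definition left_ideal :: "'a::ring_1 set \<Rightarrow> bool" where
  "left_ideal L \<longleftrightarrow> 0 \<in> L \<and> (\<forall>x\<in>L. \<forall>y\<in>L. x + y \<in> L) \<and> (\<forall>r. \<forall>x\<in>L. r * x \<in> L)"

definition maximal_left_ideal :: "'a::ring_1 set \<Rightarrow> bool" where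
  "maximal_left_ideal L \<longleftrightarrow> left_ideal L \<and> L \<noteq> UNIV \<and>
     (\<forall>L'. left_ideal L' \<and> L \<subseteq> L' \<longrightarrow> L' = L \<or> L' = UNIV)"

text \<open>Jacobson radical: intersection of all maximal left ideals.\<close>
definition jac :: "'a::ring_1 set" where
  "jac = \<Inter> {L. maximal_left_ideal L}"

text \<open>R/J(R) is semisimple (artinian): every left ideal of R/J(R) is a direct summand,
  expressed via the correspondence of left ideals of R/J(R) with left ideals of R containing J(R).\<close>
definition semilocal :: "'a::ring_1 itself \<Rightarrow> bool" where
  "semilocal _ \<longleftrightarrow> (\<forall>L::'a set. left_ideal L \<and> jac \<subseteq> L \<longrightarrow>
     (\<exists>L'. left_ideal L' \<and> jac \<subseteq> L' \<and> {x + y | x y. x \<in> L \<and> y \<in> L'} = UNIV \<and> L \<inter> L' = jac))"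

text \<open>R local: R/J(R) is a division ring (nonzero, all nonzero classes invertible).\<close>
definition local_ring :: "'a::ring_1 itself \<Rightarrow> bool" where
  "local_ring _ \<longleftrightarrow> (1::'a) \<notin> jac \<and>
     (\<forall>x::'a. x \<notin> jac \<longrightarrow> (\<exists>y. x * y - 1 \<in> jac \<and> y * x - 1 \<in> jac))"

definition GWNC :: "'a::ring_1 itself \<Rightarrow> bool" where
  "GWNC _ \<longleftrightarrow> (\<forall>a::'a. \<not> is_unit a \<longrightarrow>
     (\<exists>q e. nilp q \<and> idem e \<and> (a = q + e \<or> a = q - e)))"

definition weakly_nil_clean :: "'a::ring_1 itself \<Rightarrow> bool" where
  "weakly_nil_clean _ \<longleftrightarrow> (\<forall>a::'a. \<exists>e. idem e \<and> (nilp (a - e) \<or> nilp (a + e)))"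

definition nil_set :: "'a::ring_1 set \<Rightarrow> bool" where
  "nil_set I \<longleftrightarrow> (\<forall>x\<in>I. nilp x)"

text \<open>R/I is isomorphic to the ring (S, pl, ml, o, z): there is a surjective unital ring
  homomorphism from R onto S with kernel I (first isomorphism theorem).\<close>
definition quot_iso :: "'a::ring_1 set \<Rightarrow> ('b \<Rightarrow> 'b \<Rightarrow> 'b) \<Rightarrow> ('b \<Rightarrow> 'b \<Rightarrow> 'b) \<Rightarrow> 'b \<Rightarrow> 'b \<Rightarrow> bool" where
  "quot_iso I pl ml un z \<longleftrightarrow> (\<exists>f::'a \<Rightarrow> 'b.
     (\<forall>x y. f (x + y) = pl (f x) (f y)) \<and> (\<forall>x y. f (x * y) = ml (f x) (f y)) \<and>
     f 1 = un \<and> surj f \<and> {x. f x = z} = I)"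

text \<open>R/J(R) \<cong> M_2(Z_3): matrices over the ring 3 = Z/3Z with matrix product.\<close>
definition quot_M2Z3 :: "'a::ring_1 itself \<Rightarrow> bool" where
  "quot_M2Z3 _ \<longleftrightarrow> quot_iso (jac :: 'a set) (+) (**) (mat 1 :: 3^2^2) 0"

text \<open>R/J(R) \<cong> Z_3 \<times> Z_3 with componentwise operations.\<close>
definition quot_Z3Z3 :: "'a::ring_1 itself \<Rightarrow> bool" where
  "quot_Z3Z3 _ \<longleftrightarrow> quot_iso (jac :: 'a set)
     (\<lambda>(a,b) (c,d). (a + c, b + d)) (\<lambda>(a,b) (c,d). (a * c, b * d)) ((1::3), (1::3)) (0, 0)"

end

theory Submission
  imports Defs
begin

text \<open>
  A GWNC ring has nil Jacobson radical \<open>J\<close>, because a nonunit \<open>j = q \<plusminus> e\<close> in \<open>J\<close> forces the idempotent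
  \<open>e\<close> into \<open>J\<close>; idempotents lift modulo \<open>J\<close>, so everything is decided in the semisimple ring
  \<open>S = R/J\<close>. Instead of the Wedderburn--Artin theorem we use orthogonal primitive idempotents of \<open>S\<close>.
  If \<open>S\<close> is not a division ring, then a comparison of \<open>Se\<close> and \<open>Sf\<close> shows that an element
  \<open>a = q \<plusminus> f\<close> of a primitive corner \<open>eSe\<close> is \<open>0\<close> or \<open>\<plusminus>e\<close>. So \<open>6 = 0\<close> in \<open>S\<close>,
  and \<open>3\<close> and \<open>4\<close> are the central idempotents that split \<open>S\<close> into its parts
  of characteristic 2 and 3. The part of characteristic 2 is nil-clean: block triangular decomposition
  reduces the claim to an element without invariant summand, which acts as a companion matrix, and for
  that an idempotent is written down. In the part of characteristic 3 the element \<open>a = e\<^sub>1 - e\<^sub>2\<close> is a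
  nonunit unless \<open>e\<^sub>1 + e\<^sub>2 = 1\<close>; if \<open>a = q + f\<close>, then \<open>f\<close> has rank at most 2 and trace 0 modulo 3, whence
  \<open>f = 0\<close>, which is absurd. So either \<open>S\<close> is \<open>M\<^sub>2(\<int>\<^sub>3)\<close> or \<open>\<int>\<^sub>3 \<times> \<int>\<^sub>3\<close>, or its part of characteristic 3 is
  \<open>0\<close> or \<open>\<int>\<^sub>3\<close> and \<open>S\<close> is weakly nil-clean.
\<close>

subsection \<open>The Jacobson radical\<close>

lemma left_idealD:
  assumes "left_ideal L"
  shows "0 \<in> L" "x \<in> L \<Longrightarrow> y \<in> L \<Longrightarrow> x + y \<in> L" "x \<in> L \<Longrightarrow> r * x \<in> L"
    "x \<in> L \<Longrightarrow> - x \<in> L" "x \<in> L \<Longrightarrow> y \<in> L \<Longrightarrow> x - y \<in> L"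
proof -
  show 0: "0 \<in> L" "x \<in> L \<Longrightarrow> y \<in> L \<Longrightarrow> x + y \<in> L" "x \<in> L \<Longrightarrow> r * x \<in> L" for x y r
    using assms unfolding left_ideal_def by blast+
  show 1: "x \<in> L \<Longrightarrow> - x \<in> L" for x using 0(3)[of x "-1"] by simp
  show "x \<in> L \<Longrightarrow> y \<in> L \<Longrightarrow> x - y \<in> L" for x y using 0(2)[of x "-y"] 1[of y] by simp
qed

lemma left_ideal_one: "left_ideal L \<Longrightarrow> 1 \<in> L \<longleftrightarrow> L = UNIV"
  using left_idealD(3)[of L 1] by auto

lemma left_ideal_principal: "left_ideal {r * x |r. True}"
  unfolding left_ideal_def
proof (intro conjI ballI allI)
  show "0 \<in> {r * x |r. True}" by (auto intro: exI[of _ 0])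
  fix a b assume "a \<in> {r * x |r. True}" "b \<in> {r * x |r. True}"
  then obtain r s where "a = r * x" "b = s * x" by auto
  then have "a + b = (r + s) * x" by (simp add: algebra_simps)
  then show "a + b \<in> {r * x |r. True}" by blast
next
  fix r a assume "a \<in> {r * x |r. True}"
  then obtain s where "a = s * x" by auto
  then have "r * a = (r * s) * x" by (simp add: mult.assoc)
  then show "r * a \<in> {r * x |r. True}" by blast
qed

lemma left_ideal_sum:
  assumes "left_ideal L" "left_ideal M"
  shows "left_ideal {x + y |x y. x \<in> L \<and> y \<in> M}"
  unfolding left_ideal_def
proof (intro conjI ballI allI)
  show "0 \<in> {x + y |x y. x \<in> L \<and> y \<in> M}"
    using assms left_idealD(1) by force
next
  fix a b assume "a \<in> {x + y |x y. x \<in> L \<and> y \<in> M}" "b \<in> {x + y |x y. x \<in> L \<and> y \<in> M}"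
  then obtain x y x' y' where *: "a = x + y" "b = x' + y'" "x \<in> L" "y \<in> M" "x' \<in> L" "y' \<in> M" by auto
  have "a + b = (x + x') + (y + y')" using * by (simp add: algebra_simps)
  then show "a + b \<in> {x + y |x y. x \<in> L \<and> y \<in> M}"
    using * assms left_idealD(2) by blast
next
  fix r a assume "a \<in> {x + y |x y. x \<in> L \<and> y \<in> M}"
  then obtain x y where *: "a = x + y" "x \<in> L" "y \<in> M" by auto
  have "r * a = r * x + r * y" using * by (simp add: algebra_simps)
  then show "r * a \<in> {x + y |x y. x \<in> L \<and> y \<in> M}"
    using * assms left_idealD(3) by blast
qed

lemma left_ideal_Union_chain:
  assumes "\<C> \<noteq> {}" "\<And>L. L \<in> \<C> \<Longrightarrow> left_ideal L"
    and "\<And>L M. L \<in> \<C> \<Longrightarrow> M \<in> \<C> \<Longrightarrow> L \<subseteq> M \<or> M \<subseteq> L"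
  shows "left_ideal (\<Union>\<C>)"
  unfolding left_ideal_def
proof (intro conjI ballI allI)
  show "0 \<in> \<Union>\<C>" using assms(1,2) left_idealD(1) by blast
next
  fix x y assume "x \<in> \<Union>\<C>" "y \<in> \<Union>\<C>"
  then obtain L M where "L \<in> \<C>" "x \<in> L" "M \<in> \<C>" "y \<in> M" by auto
  then obtain N where "N \<in> \<C>" "x \<in> N" "y \<in> N" using assms(3)[of L M] by auto
  then show "x + y \<in> \<Union>\<C>" using assms(2) left_idealD(2) by blast
next
  fix r x assume "x \<in> \<Union>\<C>"
  then show "r * x \<in> \<Union>\<C>" using assms(2) left_idealD(3) by blast
qed

lemma exists_maximal_left_ideal:
  assumes "left_ideal L" "1 \<notin> L"
  obtains M where "maximal_left_ideal M" "L \<subseteq> M"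
proof -
  \<comment> \<open>Properness is recorded as \<open>1 \<notin> M\<close>, a property that survives
    unions of chains, so Zorn's lemma applies.\<close>
  define A where "A = {M. left_ideal M \<and> L \<subseteq> M \<and> 1 \<notin> M}"
  have "\<exists>M\<in>A. \<forall>X\<in>A. M \<subseteq> X \<longrightarrow> X = M"
  proof (rule subset_Zorn_nonempty)
    show "A \<noteq> {}" using assms A_def by auto
    fix \<C> assume C: "\<C> \<noteq> {}" "subset.chain A \<C>"
    have "left_ideal (\<Union>\<C>)"
      using C by (intro left_ideal_Union_chain) (auto simp: subset_chain_def A_def)
    then show "\<Union>\<C> \<in> A" using C by (auto simp: subset_chain_def A_def)
  qed
  then obtain M where M: "M \<in> A" "\<And>X. X \<in> A \<Longrightarrow> M \<subseteq> X \<Longrightarrow> X = M" by blast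
  have "maximal_left_ideal M" unfolding maximal_left_ideal_def
  proof (intro conjI allI impI)
    show "left_ideal M" "M \<noteq> UNIV" using M(1) A_def by auto
    fix L' assume L': "left_ideal L' \<and> M \<subseteq> L'"
    show "L' = M \<or> L' = UNIV"
      using M(1) M(2)[of L'] L' left_ideal_one[of L'] unfolding A_def by auto
  qed
  then show thesis using that M(1) A_def by auto
qed

lemma left_ideal_jac: "left_ideal (jac :: 'a::ring_1 set)"
proof -
  have "left_ideal (\<Inter>\<M>)" if "\<And>M. M \<in> \<M> \<Longrightarrow> left_ideal M" for \<M> :: "'a set set"
    using that unfolding left_ideal_def by (meson InterE InterI)
  from this[of "Collect maximal_left_ideal"] show ?thesis
    unfolding jac_def by (simp add: maximal_left_ideal_def)
qed

text \<open>If \<open>1 - y * x\<close> has no left inverse, the left ideal it generates lies in a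
  maximal one, which contains \<open>x\<close>, hence \<open>y * x\<close>, hence 1. Conversely, if
  a maximal \<open>M\<close> misses \<open>x\<close>, then \<open>M + Rx = R\<close> puts some
  \<open>1 - y * x\<close> into \<open>M\<close>, and its left inverse puts 1 there.\<close>

lemma jac_iff_left_inverse: "x \<in> jac \<longleftrightarrow> (\<forall>y. \<exists>c. c * (1 - y * x) = 1)"
proof
  assume x: "x \<in> jac"
  show "\<forall>y. \<exists>c. c * (1 - y * x) = 1"
  proof (rule ccontr)
    assume "\<not> ?thesis"
    then obtain y where y: "\<And>c. c * (1 - y * x) \<noteq> 1" by auto
    define L where "L = {r * (1 - y * x) |r. True}"
    have "left_ideal L" "1 \<notin> L" unfolding L_def using left_ideal_principal y by (blast, force)
    then obtain M where M: "maximal_left_ideal M" "L \<subseteq> M" using exists_maximal_left_ideal by blast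
    have li: "left_ideal M" "M \<noteq> UNIV" using M(1) by (auto simp: maximal_left_ideal_def)
    have "x \<in> M" using x M(1) by (auto simp: jac_def)
    then have "y * x \<in> M" using left_idealD(3)[OF li(1)] by blast
    moreover have "1 - y * x \<in> M" using M(2) unfolding L_def by (auto intro: exI[of _ 1])
    ultimately have "1 \<in> M" using left_idealD(2)[OF li(1)] by force
    then show False using left_ideal_one li by blast
  qed
next
  assume *: "\<forall>y. \<exists>c. c * (1 - y * x) = 1"
  show "x \<in> jac" unfolding jac_def
  proof (rule InterI, clarify)
    fix M :: "'a set" assume M: "maximal_left_ideal M"
    then have li: "left_ideal M" "M \<noteq> UNIV" by (auto simp: maximal_left_ideal_def)
    define N where "N = {a + b |a b. a \<in> M \<and> b \<in> {r * x |r. True}}"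
    have N: "left_ideal N" unfolding N_def by (intro left_ideal_sum li left_ideal_principal)
    have MN: "M \<subseteq> N" unfolding N_def by (force intro: exI[of _ 0])
    have xN: "x \<in> N" unfolding N_def using left_idealD(1)[OF li(1)] by (force intro: exI[of _ 1])
    have "N \<noteq> UNIV"
    proof
      assume "N = UNIV"
      then have "1 \<in> N" by simp
      then obtain a y where "1 = a + y * x" "a \<in> M" unfolding N_def by auto
      then have a: "a = 1 - y * x" by (simp add: algebra_simps)
      obtain c where "c * (1 - y * x) = 1" using * by blast
      then have "1 \<in> M" using left_idealD(3)[OF li(1) \<open>a \<in> M\<close>, of c] a by simp
      then show False using left_ideal_one li by blast
    qed
    then show "x \<in> M" using M N MN xN unfolding maximal_left_ideal_def by blast
  qed
qed

lemma jac_mult_right: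
  assumes "x \<in> jac" shows "x * r \<in> jac"
  unfolding jac_iff_left_inverse
proof
  fix y
  obtain c where c: "c * (1 - (r * y) * x) = 1" using assms jac_iff_left_inverse by blast
  \<comment> \<open>If \<open>c\<close> is a left inverse of \<open>1 - b * a\<close>, then
    \<open>1 + a * c * b\<close> is one of \<open>1 - a * b\<close>; here \<open>a = y * x\<close>
    and \<open>b = r\<close>. This is what makes the radical two-sided.\<close>
  have "(1 + y * x * c * r) * (1 - y * (x * r)) = 1 - y * x * r + y * x * (c * (1 - (r * y) * x)) * r"
    by (simp add: algebra_simps)
  then show "\<exists>c. c * (1 - y * (x * r)) = 1" unfolding c by (intro exI) simp
qed

lemmas jac_simps = left_idealD[OF left_ideal_jac] jac_mult_right

text \<open>A left inverse \<open>c\<close> of \<open>1 - x\<close> is again of the form 1 minus a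
  radical element, so it has a left inverse too, which must be \<open>1 - x\<close>.\<close>

lemma one_minus_jac_unit:
  assumes "x \<in> jac" shows "is_unit (1 - x)"
proof -
  obtain c where c: "c * (1 - x) = 1" using jac_iff_left_inverse[of x] assms by (metis mult_1)
  have c': "c = 1 - (- c) * x" using c by (simp add: algebra_simps)
  obtain d where "d * c = 1" using jac_iff_left_inverse[of x] assms c' by metis
  then have "d = 1 - x" using c by (metis mult.assoc mult_1 mult.right_neutral)
  then show ?thesis using c \<open>d * c = 1\<close> unfolding is_unit_def by blast
qed

lemma one_notin_jac: "(1::'a::ring_1) \<notin> jac"
proof
  assume "(1::'a) \<in> jac"
  from one_minus_jac_unit[OF this] show False by (simp add: is_unit_def)
qed

text \<open>Both \<open>x * y\<close> and \<open>y * x\<close> are 1 plus a radical element, hence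
  units; so \<open>x\<close> has an inverse on each side.\<close>

lemma unit_mod_jac:
  assumes "x * y - 1 \<in> jac" "y * x - 1 \<in> jac"
  shows "is_unit x"
proof -
  have "is_unit (x * y)" "is_unit (y * x)"
    using one_minus_jac_unit[OF left_idealD(4)[OF left_ideal_jac]] assms by force+
  then obtain a b where "x * y * a = 1" "b * (y * x) = 1" unfolding is_unit_def by blast
  then have "x * (y * a) = 1" "(b * y) * x = 1" by (simp_all add: mult.assoc)
  then have "y * a = b * y" by (metis mult.assoc mult_1 mult.right_neutral)
  then show ?thesis using \<open>x * (y * a) = 1\<close> \<open>(b * y) * x = 1\<close> unfolding is_unit_def by auto
qed

section \<open>Nilpotents, idempotents and lifting modulo the radical\<close>

lemma nilp_minus: "nilp (- x) \<longleftrightarrow> nilp x"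
proof -
  have "nilp (- x)" if "nilp x" for x :: 'a
  proof -
    obtain n where "x ^ n = 0" using \<open>nilp x\<close> nilp_def by blast
    then have "(- x) ^ n = 0" by (simp add: power_minus[of x])
    then show ?thesis using nilp_def by blast
  qed
  from this[of x] this[of "- x"] show ?thesis by auto
qed

lemma idem_power: "idem e \<Longrightarrow> e ^ Suc n = e"
  by (induction n) (auto simp: idem_def)

text \<open>Modulo \<open>J\<close> the idempotent \<open>e\<close> is congruent to a nilpotent, so
  a power of \<open>e\<close>, that is \<open>e\<close> itself, lies in \<open>J\<close>. Then
  \<open>1 - e\<close> is a unit that annihilates \<open>e\<close>, so \<open>e = 0\<close> and
  \<open>j\<close> is the nilpotent summand.\<close>

lemma GWNC_jac_nil:
  assumes "GWNC TYPE('a::ring_1)" shows "nil_set (jac :: 'a set)"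
  unfolding nil_set_def
proof
  fix j :: 'a assume j: "j \<in> jac"
  have nu: "\<not> is_unit j"
  proof
    assume "is_unit j"
    then obtain y where "y * j = 1" by (auto simp: is_unit_def)
    then show False using left_idealD(3)[OF left_ideal_jac j, of y] by (simp add: one_notin_jac)
  qed
  obtain q e where qe: "nilp q" "idem e" "j = q + e \<or> j = q - e"
    using assms nu unfolding GWNC_def by blast
  obtain q' where q': "nilp q'" "e + q' \<in> jac" 
    using qe(3) 
  proof
    assume "j = q + e" then show ?thesis using that[of q] j qe by (simp add: add.commute)
  next
    assume "j = q - e" then show ?thesis using that[of "-q"] jac_simps(4)[OF j] qe nilp_minus by force
  qed
  have mod: "e ^ n - (- q') ^ n \<in> jac" for n
  proof (induction n)
    case 0 then show ?case using jac_simps(1) by simp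
  next
    case (Suc n)
    have "e ^ Suc n - (- q') ^ Suc n = e * (e ^ n - (- q') ^ n) + (e + q') * (- q') ^ n"
      by (simp add: algebra_simps)
    then show ?case using Suc q'(2) jac_simps(2,3,6) by metis
  qed
  obtain n where "q' ^ n = 0" using q' nilp_def by blast
  then have "(- q') ^ Suc n = 0" by (simp add: power_minus[of q'])
  with mod[of "Suc n"] have "e \<in> jac" using idem_power[OF qe(2)] by simp
  then have "is_unit (1 - e)" by (rule one_minus_jac_unit)
  then obtain z where "z * (1 - e) = 1" by (auto simp: is_unit_def)
  then have "e = z * ((1 - e) * e)" by (metis mult.assoc mult_1)
  then have "e = 0" using qe(2) by (simp add: idem_def algebra_simps)
  then show "nilp j" using qe by auto
qed

text \<open>Newton's iteration \<open>x \<mapsto> 3 x\<^sup>2 - 2 x\<^sup>3\<close> for the equation \<open>x\<^sup>2 = x\<close>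
  squares the defect \<open>x\<^sup>2 - x\<close> up to a commuting factor.\<close>

lemma idempotent_lift:
  fixes x :: "'a::ring_1"
  assumes "nil_set (jac :: 'a set)" "x * x - x \<in> jac"
  obtains e where "idem e" "e - x \<in> jac"
proof -
  have "(x * x - x) ^ k = 0 \<Longrightarrow> x * x - x \<in> jac \<Longrightarrow> \<exists>e. idem e \<and> e - x \<in> jac" for k
  proof (induction k arbitrary: x rule: less_induct)
    case (less k)
    define d where "d = x * x - x"
    show ?case
    proof (cases "k \<le> 1")
      case True
      then have "d = 0" using less.prems d_def by (cases k) auto
      then show ?thesis using jac_simps(1) by (intro exI[of _ x]) (simp add: d_def idem_def)
    next
      case False
      define x' where "x' = x * x + x * x + x * x - (x * x * x + x * x * x)"
      \<comment> \<open>With \<open>d = x * x - x\<close> this is \<open>4 d - 3\<close>, the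
        cofactor of \<open>d * d\<close> in the new defect.\<close>
      define s where "s = x * x + x * x + x * x + x * x - (x + x + x + x) - 1 - 1 - 1"
      have xx: "x' - x = (1 - (x + x)) * d" 
        unfolding x'_def d_def by (simp add: algebra_simps)
      have d': "x' * x' - x' = (d * d) * s"
        unfolding x'_def d_def s_def by (simp add: algebra_simps)
      have comm: "d * s = s * d" unfolding d_def s_def by (simp add: algebra_simps)
      have "((d * d) * s) ^ m = d ^ (2 * m) * s ^ m" for m
      proof -
        have "(d * d) * s = s * (d * d)" using comm by (metis mult.assoc)
        then have "((d * d) * s) ^ m = (d * d) ^ m * s ^ m" 
            by (induction m) (simp_all, metis mult.assoc power_commuting_commutes)
        then show ?thesis by (simp add: power_mult power2_eq_square)
      qed
      then have "(x' * x' - x') ^ (k - 1) = d ^ (2 * (k - 1)) * s ^ (k - 1)" using d' by simp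
      \<comment> \<open>For \<open>k > 1\<close> the doubled exponent \<open>2 * (k - 1)\<close> is
        at least \<open>k\<close>, so the nilpotency bound drops by one, which suffices for the
        induction.\<close>
      also have "2 * (k - 1) = k + (k - 2)" using False by simp
      also have "d ^ (k + (k - 2)) = 0" using less.prems(1) by (simp add: d_def power_add)
      finally have z: "(x' * x' - x') ^ (k - 1) = 0" by simp
      have "d \<in> jac" using less.prems d_def by simp
      then have J: "x' * x' - x' \<in> jac" "x' - x \<in> jac" unfolding d' xx by (auto intro: jac_simps)
      obtain e where e: "idem e" "e - x' \<in> jac" using less.IH[OF _ z J(1)] False by auto
      have "e - x = (e - x') + (x' - x)" by simp
      then show ?thesis using e J jac_simps(2) by metis
    qed
  qed
  moreover obtain k where "(x * x - x) ^ k = 0" using assms by (auto simp: nil_set_def nilp_def)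
  ultimately show thesis using assms that by blast
qed

lemma nilp_mod_jac:
  fixes x :: "'a::ring_1"
  assumes "nil_set (jac :: 'a set)" "x ^ n \<in> jac" shows "nilp x"
proof -
  obtain k where "(x ^ n) ^ k = 0" using assms by (auto simp: nil_set_def nilp_def)
  then show ?thesis unfolding nilp_def by (metis power_mult)
qed

section \<open>From the listed classes of rings to GWNC\<close>

lemma GWNC_if_quadratic:
  assumes nil: "nil_set (jac :: 'a::ring_1 set)"
    and "\<And>a::'a. \<not> is_unit a \<Longrightarrow> a * a \<in> jac \<or> a * a - a \<in> jac \<or> a * a + a \<in> jac"
  shows "GWNC TYPE('a)"
  unfolding GWNC_def
proof (intro allI impI)
  fix a :: 'a assume "\<not> is_unit a"
  \<comment> \<open>Modulo \<open>J\<close> the element is square-zero, idempotent, or minus an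
    idempotent. In the first case it is itself nilpotent and \<open>e = 0\<close> serves; in the
    others the idempotent is lifted and the error lies in the nil ideal \<open>J\<close>.\<close>
  then consider "a * a \<in> jac" | "a * a - a \<in> jac" | "a * a + a \<in> jac" using assms by blast
  then show "\<exists>q e. nilp q \<and> idem e \<and> (a = q + e \<or> a = q - e)"
  proof cases
    case 1
    then have "nilp a" using nilp_mod_jac[of a 2] nil by (simp add: power2_eq_square)
    then show ?thesis by (intro exI[of _ a] exI[of _ 0]) (simp add: idem_def)
  next
    case 2
    obtain e where "idem e" "e - a \<in> jac" using idempotent_lift[OF nil 2] by blast
    then have "nilp (a - e)" using nil nilp_minus[of "a - e"] by (auto simp: nil_set_def)
    then show ?thesis using \<open>idem e\<close> by (intro exI[of _ "a - e"] exI[of _ e]) simp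
  next
    case 3
    then have "(- a) * (- a) - (- a) \<in> jac" by simp
    then obtain e where e: "idem e" "e - (- a) \<in> jac" using idempotent_lift[OF nil] by blast
    then have "nilp (a + e)" using nil by (auto simp: nil_set_def add.commute)
    then show ?thesis using \<open>idem e\<close> by (intro exI[of _ "a + e"] exI[of _ e]) simp
  qed
qed

lemma local_imp_GWNC:
  assumes "local_ring TYPE('a::ring_1)" "nil_set (jac :: 'a set)"
  shows "GWNC TYPE('a)"
proof (rule GWNC_if_quadratic[OF assms(2)])
  fix a :: 'a assume "\<not> is_unit a"
  then have "a \<in> jac" using assms(1) unit_mod_jac unfolding local_ring_def by blast
  then show "a * a \<in> jac \<or> a * a - a \<in> jac \<or> a * a + a \<in> jac" using jac_simps(3) by blast
qed

lemma weakly_nil_clean_imp_GWNC: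
  assumes "weakly_nil_clean TYPE('a::ring_1)" shows "GWNC TYPE('a)"
  unfolding GWNC_def
proof (intro allI impI)
  fix a :: 'a
  obtain e where "idem e" "nilp (a - e) \<or> nilp (a + e)"
    using assms unfolding weakly_nil_clean_def by blast
  moreover have "a = (a - e) + e" "a = (a + e) - e" by simp_all
  ultimately show "\<exists>q e. nilp q \<and> idem e \<and> (a = q + e \<or> a = q - e)"
    by blast
qed

lemma Z3_cases: "(x::3) = 0 \<or> x = 1 \<or> x = -1"
proof (cases x)
  case (of_int z)
  then have "z = 0 \<or> z = 1 \<or> z = 2" by auto
  then show ?thesis using of_int by auto
qed

text \<open>A nonunit has a zero component, and the other component is 0, 1 or -1; so the pair is
  zero, idempotent or minus an idempotent.\<close>

lemma quot_Z3Z3_imp_GWNC: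
  assumes "quot_Z3Z3 TYPE('a::ring_1)" "nil_set (jac :: 'a set)"
  shows "GWNC TYPE('a)"
proof (rule GWNC_if_quadratic[OF assms(2)])
  obtain f :: "'a \<Rightarrow> 3 \<times> 3" where f: 
     "\<And>x y. f (x + y) = (\<lambda>(a,b) (c,d). (a + c, b + d)) (f x) (f y)" 
     "\<And>x y. f (x * y) = (\<lambda>(a,b) (c,d). (a * c, b * d)) (f x) (f y)" 
     "f 1 = (1,1)" "surj f" "{x. f x = (0,0)} = jac"
    using assms unfolding quot_Z3Z3_def quot_iso_def by blast
  have add: "f (x + y) = f x + f y" for x y by (auto simp: f(1) split: prod.splits)
  have mul: "fst (f (x * y)) = fst (f x) * fst (f y)" "snd (f (x * y)) = snd (f x) * snd (f y)" for x y
    by (auto simp: f(2) split: prod.splits)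
  have diff: "f (x - y) = f x - f y" for x y using add[of "x - y" y] by simp
  have ker: "x \<in> jac \<longleftrightarrow> f x = 0" for x using f(5) by (auto simp: zero_prod_def)
  fix a :: 'a assume nu: "\<not> is_unit a"
  obtain p q where pq: "f a = (p, q)" by fastforce
  have "p = 0 \<or> q = 0"
  proof (rule ccontr)
    assume "\<not> ?thesis"
    \<comment> \<open>Nonzero residues modulo 3 square to 1, so \<open>a\<close> would be its own
      inverse modulo \<open>J\<close>.\<close>
    then have "p * p = 1" "q * q = 1" using Z3_cases[of p] Z3_cases[of q] by auto
    then have "f (a * a - 1) = 0" using mul[of a a] pq f(3)
      by (simp add: diff prod_eq_iff)
    then show False using nu unit_mod_jac[of a a] ker by blast
  qed
  then have "f (a * a) = 0 \<or> f (a * a) - f a = 0 \<or> f (a * a) + f a = 0"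
    using Z3_cases[of p] Z3_cases[of q] mul[of a a] pq by (auto simp: prod_eq_iff)
  then show "a * a \<in> jac \<or> a * a - a \<in> jac \<or> a * a + a \<in> jac"
    by (simp add: ker add diff)
qed

lemma matrix_2_eq_iff:
  "(A :: 'a^2^2) = B \<longleftrightarrow> A$1$1 = B$1$1 \<and> A$1$2 = B$1$2 \<and> A$2$1 = B$2$1 \<and> A$2$2 = B$2$2"
  by (auto simp: vec_eq_iff forall_2)

lemma matrix_mult_2: "((A :: 'a::semiring_1^2^2) ** B)$i$j = A$i$1 * B$1$j + A$i$2 * B$2$j"
  by (simp add: matrix_matrix_mult_def sum_2)

text \<open>A nonunit has determinant 0, so Cayley-Hamilton reads \<open>A ** A = t * A\<close>
  entrywise with the trace \<open>t\<close> in {0, 1, -1}, which yields the three quadratic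
  cases.\<close>

lemma quot_M2Z3_imp_GWNC:
  assumes "quot_M2Z3 TYPE('a::ring_1)" "nil_set (jac :: 'a set)"
  shows "GWNC TYPE('a)"
proof (rule GWNC_if_quadratic[OF assms(2)])
  obtain f :: "'a \<Rightarrow> 3^2^2" where f: 
     "\<And>x y. f (x + y) = f x + f y" "\<And>x y. f (x * y) = f x ** f y"
     "f 1 = mat 1" "surj f" "{x. f x = 0} = jac"
    using assms unfolding quot_M2Z3_def quot_iso_def by blast
  have diff: "f (x - y) = f x - f y" for x y using f(1)[of "x - y" y] by simp
  have ker: "x \<in> jac \<longleftrightarrow> f x = 0" for x using f(5) by auto
  fix a :: 'a assume nu: "\<not> is_unit a"
  define A where "A = f a"
  define d where "d = A$1$1 * A$2$2 - A$1$2 * A$2$1"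
  have "d = 0"
  proof (rule ccontr)
    assume "d \<noteq> 0"
    then have dd: "d * d = 1" using Z3_cases[of d] by auto
    \<comment> \<open>\<open>B\<close> is \<open>d\<close> times the adjugate of \<open>A\<close>;
      this is the inverse because \<open>d\<close> is its own inverse.\<close>
    define B where "B = ((\<chi> i j. if i = j then d * (A$1$1 + A$2$2 - A$i$i) else - d * A$i$j) :: 3^2^2)"
    have "A ** B = mat 1" "B ** A = mat 1"
      using dd by (auto simp: matrix_2_eq_iff matrix_mult_2 B_def d_def mat_def algebra_simps)
    moreover obtain b where "f b = B" using f(4) by (metis surj_def)
    ultimately have "f (a * b - 1) = 0" "f (b * a - 1) = 0" by (simp_all add: diff f A_def)
    then show False using nu unit_mod_jac[of a b] ker by blast
  qed
  define t where "t = A$1$1 + A$2$2"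
  have AA: "(A ** A)$i$j = t * A$i$j" for i j
  proof -
    have "(A ** A)$i$j = t * A$i$j - (if i = j then d else 0)"
      using exhaust_2[of i] exhaust_2[of j] by (auto simp: matrix_mult_2 t_def d_def algebra_simps)
    then show ?thesis using \<open>d = 0\<close> by simp
  qed
  have "A ** A = 0 \<or> A ** A - A = 0 \<or> A ** A + A = 0"
    using Z3_cases[of t] AA by (auto simp: vec_eq_iff)
  then show "a * a \<in> jac \<or> a * a - a \<in> jac \<or> a * a + a \<in> jac"
    by (simp add: ker f diff A_def)
qed

subsection \<open>Regularity, primitive idempotents and their corners\<close>

text \<open>In a semisimple ring \<open>S\<close> this means that \<open>Se\<close> is a simple left
  module and \<open>eSe\<close> a division ring.\<close>

definition primitive :: "'a::ring_1 \<Rightarrow> bool" where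
  "primitive e \<longleftrightarrow> idem e \<and> e \<noteq> 0 \<and> (\<forall>h. idem h \<and> e * h = h \<and> h * e = h \<longrightarrow> h = 0 \<or> h = e)"

lemma mult_absorb_left: "a * b = c \<Longrightarrow> a * (b * x) = c * x"
  for a :: "'a::semigroup_mult" by (simp flip: mult.assoc)

text \<open>The strict order on idempotents by inclusion of corners. It carries the inductions below
  once it is known to be well-founded.\<close>

definition idem_less :: "('a::ring_1 \<times> 'a) set" where
  "idem_less = {(h, g). idem h \<and> idem g \<and> g * h = h \<and> h * g = h \<and> h \<noteq> g}"

locale semisimple_ring =
  fixes T :: "'a::ring_1 itself"
  assumes complement: "\<And>L :: 'a set. left_ideal L \<Longrightarrow>
    \<exists>L'. left_ideal L' \<and> {x + y |x y. x \<in> L \<and> y \<in> L'} = UNIV \<and> L \<inter> L' = {0}"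
begin

text \<open>Write \<open>1 = a + b\<close> along the decomposition into \<open>L\<close> and a
  complement. For \<open>y\<close> in \<open>L\<close> the element \<open>y * b = y - y * a\<close>
  lies in both summands and so vanishes.\<close>

lemma left_ideal_generator:
  assumes "left_ideal (L :: 'a set)"
  obtains a where "a \<in> L" "\<And>y. y \<in> L \<Longrightarrow> y * a = y"
proof -
  obtain L' where L': "left_ideal L'" "{x + y |x y. x \<in> L \<and> y \<in> L'} = UNIV" "L \<inter> L' = {0}"
    using complement[OF assms] by (elim exE conjE)
  then have "1 \<in> {x + y |x y. x \<in> L \<and> y \<in> L'}" by simp
  then obtain a b where ab: "1 = a + b" "a \<in> L" "b \<in> L'" by auto
  have "y * a = y" if "y \<in> L" for y
  proof -
    have "y * 1 = y * a + y * b" unfolding ab(1) by (simp add: distrib_left)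
    then have "y * b = y - y * a" by (simp add: algebra_simps)
    moreover have "y * b \<in> L'" "y - y * a \<in> L"
      using left_idealD(3)[OF L'(1) ab(3)] left_idealD[OF assms] that ab by auto
    ultimately have "y * b \<in> L \<inter> L'" by simp
    then show ?thesis using L'(3) \<open>y * b = y - y * a\<close> by simp
  qed
  then show thesis using that ab by blast
qed

text \<open>The right identity of the principal left ideal \<open>Sx\<close> has the form
  \<open>t * x\<close>, and it fixes \<open>x\<close>.\<close>

lemma regular:
  obtains t where "x * t * x = (x :: 'a)"
proof -
  obtain a where a: "a \<in> {r * x |r. True}" "\<And>y. y \<in> {r * x |r. True} \<Longrightarrow> y * a = y"
    using left_ideal_generator[OF left_ideal_principal] by blast
  obtain t where "a = t * x" using a(1) by auto
  moreover have "x * a = x" by (rule a(2)) (auto intro: exI[of _ 1])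
  ultimately show thesis using that[of t] by (simp add: mult.assoc)
qed

text \<open>A descending chain \<open>f i\<close> gives ascending left annihilators
  \<open>A i = S(1 - f i)\<close>. Their union has a right identity \<open>a\<close>, which already
  lies in some \<open>A k\<close>; then \<open>1 - f (Suc k)\<close> annihilates \<open>f k\<close>,
  so \<open>f (Suc k) = f k\<close>.\<close>

lemma wf_idem_less: "wf (idem_less :: ('a \<times> 'a) set)"
  unfolding wf_iff_no_infinite_down_chain
proof
  assume "\<exists>f :: nat \<Rightarrow> 'a. \<forall>i. (f (Suc i), f i) \<in> idem_less"
  then obtain f :: "nat \<Rightarrow> 'a" where f: "\<And>i. (f (Suc i), f i) \<in> idem_less" by blast
  have step: "f i * f (Suc i) = f (Suc i)" "f (Suc i) * f i = f (Suc i)" "f (Suc i) \<noteq> f i" "f i * f i = f i" for i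
    using f[of i] by (auto simp: idem_less_def idem_def)
  define A where "A i = {r * (1 - f i) |r. True}" for i
  have mem: "y \<in> A i \<longleftrightarrow> y * f i = 0" for y i
  proof
    assume "y \<in> A i"
    then show "y * f i = 0" by (auto simp: A_def mult.assoc left_diff_distrib step)
  next
    assume "y * f i = 0"
    then have "y = y * (1 - f i)" by (simp add: right_diff_distrib)
    then show "y \<in> A i" unfolding A_def by blast
  qed
  have "A i \<subseteq> A (Suc i)" for i
    using mem step by (metis mult.assoc mult_zero_left subsetI)
  then have mono: "i \<le> j \<Longrightarrow> A i \<subseteq> A j" for i j by (rule lift_Suc_mono_le)
  have "left_ideal (\<Union>(range A))"
  proof (rule left_ideal_Union_chain)
    show "left_ideal L" if "L \<in> range A" for L
      using that left_ideal_principal unfolding A_def by blast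
    show "L \<subseteq> M \<or> M \<subseteq> L" if "L \<in> range A" "M \<in> range A" for L M
      using that mono nat_le_linear by blast
  qed simp
  then obtain a where a: "a \<in> \<Union>(range A)" "\<And>y. y \<in> \<Union>(range A) \<Longrightarrow> y * a = y"
    using left_ideal_generator by blast
  then obtain k where k: "a \<in> A k" by auto
  have "(1 - f (Suc k)) * a = 1 - f (Suc k)"
    by (rule a(2)) (auto simp: mem step left_diff_distrib intro: exI[of _ "Suc k"])
  then have "(1 - f (Suc k)) * f k = (1 - f (Suc k)) * (a * f k)" by (simp flip: mult.assoc)
  also have "\<dots> = 0" using k by (simp add: mem)
  finally show False using step(2,3)[of k] by (simp add: left_diff_distrib)
qed

lemma exists_primitive:
  assumes "idem (g :: 'a)" "g \<noteq> 0"
  shows "\<exists>e. primitive e \<and> g * e = e \<and> e * g = e"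
  using assms
proof (induction g rule: wf_induct_rule[OF wf_idem_less])
  case (1 g)
  show ?case
  proof (cases "primitive g")
    case True
    then show ?thesis by (auto simp: primitive_def idem_def)
  next
    case False
    then obtain h where h: "idem h" "g * h = h" "h * g = h" "h \<noteq> 0" "h \<noteq> g"
      using 1 by (auto simp: primitive_def)
    then have "(h, g) \<in> idem_less" using 1 by (auto simp: idem_less_def)
    then obtain e where "primitive e" "h * e = e" "e * h = e" using 1 h by blast
    then show ?thesis using h by (metis mult.assoc)
  qed
qed

text \<open>This expresses the simplicity of \<open>Se\<close>. With \<open>v * t * v = v\<close>,
  the element \<open>h = e * t * v\<close> is an idempotent of the corner with
  \<open>v * h = v\<close>, so it is nonzero and equals \<open>e\<close>.\<close>

lemma primitive_left_inverse:
  assumes "primitive (e :: 'a)" "v * e = v" "v \<noteq> 0"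
  obtains y where "y * v = e" "e * y = y"
proof -
  obtain t where t: "v * t * v = v" by (rule regular)
  have ee: "e * e = e" using assms by (simp add: primitive_def idem_def)
  define h where "h = e * t * v"
  have "v * h = v" unfolding h_def using t assms(2) by (metis mult.assoc)
  then have "h \<noteq> 0" using assms(3) by auto
  moreover have "h * h = h" unfolding h_def by (metis \<open>v * h = v\<close> h_def mult.assoc)
  moreover have "e * h = h" "h * e = h" unfolding h_def using assms(2) ee by (metis mult.assoc)+
  ultimately have "h = e" using assms(1) by (auto simp: primitive_def idem_def)
  then show thesis using that[of "e * t"] ee unfolding h_def by (metis mult.assoc)
qed

lemma primitive_right_inverse:
  assumes "primitive (e :: 'a)" "e * v = v" "v \<noteq> 0"
  obtains y where "v * y = e" "y * e = y"
proof -
  obtain t where t: "v * t * v = v" by (rule regular)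
  have ee: "e * e = e" using assms by (simp add: primitive_def idem_def)
  define h where "h = v * t * e"
  have "h * v = v" unfolding h_def using t assms(2) by (metis mult.assoc)
  then have "h \<noteq> 0" using assms(3) by auto
  moreover have "h * h = h" unfolding h_def by (metis \<open>h * v = v\<close> h_def mult.assoc)
  moreover have "e * h = h" "h * e = h" unfolding h_def using assms(2) ee by (metis mult.assoc)+
  ultimately have "h = e" using assms(1) by (auto simp: primitive_def idem_def)
  then show thesis using that[of "t * e"] ee unfolding h_def by (metis mult.assoc)
qed

text \<open>A nonzero \<open>d\<close> would have a right inverse in the corner, and factors could
  be stripped from \<open>d ^ n * e = 0\<close> until \<open>e = 0\<close>.\<close>

lemma primitive_corner_nilpotent:
  assumes e: "primitive (e :: 'a)" and d: "e * d = d" "d * e = d" and "d ^ n * e = 0"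
  shows "d = 0"
proof (rule ccontr)
  assume "d \<noteq> 0"
  then obtain y where y: "d * y = e" using primitive_right_inverse e d by metis
  have "d ^ k * e = 0 \<Longrightarrow> e = 0" for k
  proof (induction k)
    case (Suc k)
    have "d ^ Suc k * e * y = d ^ k * (d * (e * y))" by (simp only: power_Suc2 mult.assoc)
    also have "d * (e * y) = e" using d y by (simp flip: mult.assoc)
    finally have "d ^ k * e = d ^ Suc k * e * y" by simp
    then show ?case using Suc by simp
  qed simp
  then show False using assms by (auto simp: primitive_def)
qed

text \<open>The idea is to follow the row vector \<open>e\<close> under right multiplication by
  \<open>q\<close>. Whether or not the simple module \<open>Se\<close> meets \<open>Sf\<close>, some
  row is multiplied by \<open>d = a - e\<close> at each step, up to terms that \<open>q\<close>
  kills. So \<open>d\<close> is nilpotent in a division ring and vanishes.\<close>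

lemma primitive_corner_nil_clean:
  assumes e: "primitive (e :: 'a)" and a: "e * a = a" "a * e = a" "a \<noteq> 0"
    and aq: "a = q + f" and q: "nilp q" and f: "idem f"
  shows "a = e"
proof -
  define d where "d = a - e"
  have ee: "e * e = e" using e by (simp add: primitive_def idem_def)
  have ff: "f * f = f" using f by (simp add: idem_def)
  have e0: "e \<noteq> 0" using e by (simp add: primitive_def)
  have q': "q = a - f" using aq by simp
  obtain n where n: "q ^ n = 0" using q by (auto simp: nilp_def)
  have d: "e * d = d" "d * e = d" by (simp_all add: d_def algebra_simps a ee)
  have "d = 0"
  proof (cases "\<exists>z. z \<noteq> 0 \<and> z * e = z \<and> z * f = z")
    case True
    then obtain z where z: "z \<noteq> 0" "z * e = z" "z * f = z" by blast
    obtain y where "y * z = e" using primitive_left_inverse e z by metis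
    \<comment> \<open>By simplicity \<open>Se\<close> lies inside \<open>Sf\<close> as soon as the
      two meet; then \<open>e * q = d\<close>.\<close>
    then have ef: "e * f = e" using z by (metis mult.assoc)
    have "e * q ^ k = d ^ k * e" for k
    proof (induction k)
      case (Suc k)
      have "e * q ^ Suc k = e * q ^ k * q" by (simp add: power_commutes mult.assoc)
      also have "\<dots> = d ^ k * (e * q)" using Suc by (simp add: mult.assoc)
      also have "e * q = d" by (simp add: q' d_def right_diff_distrib a ef)
      finally show ?case by (metis d(2) mult.assoc power_Suc2)
    qed simp
    from this[of n] n have "d ^ n * e = 0" by simp
    then show ?thesis using primitive_corner_nilpotent e d by blast
  next
    case False
    have ex: "\<exists>x y. e * q ^ k = x * e + y * f" for k
    proof (induction k)
      case 0 show ?case by (rule exI[of _ 1], rule exI[of _ 0]) simp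
    next
      case (Suc k)
      then obtain x y where "e * q ^ k = x * e + y * f" by blast
      have "e * q ^ Suc k = e * q ^ k * q" by (simp add: power_commutes mult.assoc)
      also have "\<dots> = (e * q ^ k * a) * e + (- (e * q ^ k)) * f"
        unfolding q' by (simp add: right_diff_distrib mult.assoc a)
      finally show ?case by blast
    qed
    \<comment> \<open>\<open>m\<close> is a nonzero element of \<open>Se + Sf\<close> with \<open>m q = 0\<close>, so \<open>m a = m f\<close> lies in \<open>Se \<inter> Sf = 0\<close>.\<close>
    define k where "k = (LEAST k. e * q ^ k = 0)"
    have k0: "e * q ^ k = 0" unfolding k_def by (rule LeastI[of _ n]) (simp add: n)
    then have "k \<noteq> 0" using e0 by (cases k) auto
    define m where "m = e * q ^ (k - 1)"
    have "m \<noteq> 0" unfolding m_def using not_less_Least[of "k - 1" "\<lambda>k. e * q ^ k = 0"] \<open>k \<noteq> 0\<close>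
      by (auto simp: k_def)
    have "m * q = 0" using k0 \<open>k \<noteq> 0\<close> unfolding m_def
      by (metis mult.assoc power_minus_mult not_gr_zero)
    then have "m * a = m * f" by (simp add: q' right_diff_distrib)
    then have "m * a = 0" "m * f = 0" using False a ff by (metis mult.assoc)+
    obtain x y where m: "m = x * e + y * f" using ex unfolding m_def by blast
    have "y * f = - (x * e * f)" using \<open>m * f = 0\<close> unfolding m
      by (simp add: distrib_right mult.assoc ff eq_neg_iff_add_eq_0 add.commute)
    then have m': "m = x * e - x * e * f" using m by simp
    then have "x * e \<noteq> 0" using \<open>m \<noteq> 0\<close> by auto
    moreover have "(x * e) * e = x * e" by (simp add: mult.assoc ee)
    ultimately obtain u where u: "u * (x * e) = e" using primitive_left_inverse e by metis
    have "x * e * a = x * e * f * a" using \<open>m * a = 0\<close> unfolding m' by (simp add: left_diff_distrib)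
    then have "u * (x * e) * a = u * (x * e) * f * a" by (simp add: mult.assoc)
    then have efa: "e * (f * a) = a" unfolding u by (simp add: a mult.assoc)
    obtain b where b: "a * b = e" using primitive_right_inverse e a by metis
    have efe: "e * (f * e) = e" using efa b by (metis mult.assoc)
    \<comment> \<open>The element \<open>e - e * f\<close> is killed by \<open>q\<close>, and modulo
      \<open>S(e - e * f)\<close> the row \<open>e * f\<close> is multiplied by \<open>d\<close>. At
      the end, right multiplication by \<open>f * e\<close> removes the \<open>s\<close> term and
      turns \<open>e * f\<close> into \<open>e\<close>.\<close>
    have "\<exists>s. e * f * q ^ k = d ^ k * (e * f) + s * (e - e * f)" for k
    proof (induction k)
      case 0 show ?case by (rule exI[of _ 0]) simp
    next
      case (Suc k)
      then obtain s where s: "e * f * q ^ k = d ^ k * (e * f) + s * (e - e * f)" by blast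
      have "e * f * q ^ Suc k = e * f * q ^ k * q" by (simp add: power_commutes mult.assoc)
      also have "\<dots> = d ^ k * (e * f * q) + s * ((e - e * f) * q)"
        unfolding s by (simp add: distrib_right mult.assoc)
      also have "(e - e * f) * q = 0"
        by (simp add: q' algebra_simps a efa ff)
      also have "e * f * q = d * (e * f) + a * (e - e * f)"
        by (simp add: q' d_def algebra_simps a efa ff mult_absorb_left[OF a(2)] mult_absorb_left[OF ee])
      finally have "e * f * q ^ Suc k = d ^ Suc k * (e * f) + d ^ k * a * (e - e * f)"
        by (simp add: distrib_left power_commutes mult.assoc)
           (simp add: power_commutes flip: mult.assoc)
      then show ?case by blast
    qed
    then obtain s where "0 = d ^ n * (e * f) + s * (e - e * f)" using n by (metis mult_zero_right)
    then have "0 = (d ^ n * (e * f) + s * (e - e * f)) * f * e" by simp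
    also have "\<dots> = d ^ n * e" by (simp add: algebra_simps ff mult_absorb_left[OF ff] efe)
    finally have "d ^ n * e = 0" by simp
    then show ?thesis using primitive_corner_nilpotent e d by blast
  qed
  then show ?thesis by (simp add: d_def)
qed

end

text \<open>Primitivity of 1 would mean that the ring is a division ring;
  \<open>not_division\<close> excludes that case, where nonzero corner elements may be
  units.\<close>

locale gwnc_semisimple_ring = semisimple_ring T for T :: "'a::ring_1 itself" +
  assumes GWNC: "GWNC TYPE('a)" and not_division: "\<not> primitive (1 :: 'a)"
begin

text \<open>A unit in the corner would force \<open>e = 1\<close>, so GWNC applies to every nonzero
  \<open>a\<close>; the form \<open>q - f\<close> is treated by passing to \<open>- a\<close>. Thus
  \<open>eSe\<close> has two or three elements.\<close>

lemma primitive_corner: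
  assumes e: "primitive (e :: 'a)" and a: "e * a = a" "a * e = a"
  shows "a = 0 \<or> a = e \<or> a = - e"
proof (cases "a = 0")
  case False
  have "\<not> is_unit a"
  proof
    assume "is_unit a"
    then obtain y where "a * y = 1" by (auto simp: is_unit_def)
    then have "e = 1" using a by (metis mult.assoc mult.right_neutral)
    then show False using e not_division by simp
  qed
  then obtain q f where qf: "nilp q" "idem f" "a = q + f \<or> a = q - f"
    using GWNC unfolding GWNC_def by blast
  from qf(3) show ?thesis
  proof
    assume "a = q + f"
    then show ?thesis using primitive_corner_nil_clean[OF e a False _ qf(1,2)] by simp
  next
    assume "a = q - f"
    then have "- a = - q + f" by simp
    have "- a = e"
      by (rule primitive_corner_nil_clean[OF e _ _ _ \<open>- a = - q + f\<close>])
        (use a False qf in \<open>simp_all add: nilp_minus\<close>)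
    then show ?thesis by (metis minus_minus)
  qed
qed simp

end

subsection \<open>Cyclic bases\<close>

text \<open>With \<open>k = g - h\<close> the element is block triangular: \<open>q ^ m\<close>
  annihilates the row \<open>h\<close>, and \<open>q ^ n\<close> moves the row \<open>k\<close> into
  \<open>Sh\<close>. Nilpotency of the diagonal blocks therefore suffices.\<close>

lemma nilp_lower_triangular:
  fixes g h x :: "'a::ring_1"
  assumes h: "h * h = h" "g * h = h" "h * g = h" and g: "g * g = g"
    and q1: "nilp q1" "h * q1 = q1" "q1 * h = q1"
    and q2: "nilp q2" "(g - h) * q2 = q2" "q2 * (g - h) = q2"
  shows "nilp (q1 + q2 + (g - h) * x * h)"
proof -
  define k where "k = g - h"
  define q where "q = q1 + q2 + k * x * h"
  have k: "k * k = k" "h * k = 0" "k * h = 0" "g * k = k" "k * g = k" "g = h + k"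
    unfolding k_def by (simp_all add: algebra_simps h g)
  have q2': "k * q2 = q2" "q2 * k = q2" using q2 by (simp_all add: k_def)
  have "h * q2 = h * k * q2" "k * q1 = k * h * q1" "q2 * h = q2 * (k * h)"
    using q1 q2' by (metis mult.assoc)+
  then have hq2: "h * q2 = 0" "k * q1 = 0" "q2 * h = 0" using k by simp_all
  have hq: "h * q = q1" unfolding q_def
    by (simp add: distrib_left q1 hq2 k flip: mult.assoc)
  have kq: "k * q = q2 + k * x * h" unfolding q_def
    by (simp add: distrib_left q2' hq2 k flip: mult.assoc)
  obtain m n where mn: "q1 ^ m = 0" "q2 ^ n = 0" using q1 q2 by (auto simp: nilp_def)
  have "h * q ^ i = q1 ^ i * h" for i
  proof (induction i)
    case (Suc i)
    have "h * q ^ Suc i = h * q ^ i * q" by (simp only: power_Suc2 mult.assoc)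
    also have "\<dots> = q1 ^ i * (h * q)" unfolding Suc by (simp add: mult.assoc)
    also have "h * q = q1 * h" using hq q1 by simp
    finally show ?case by (simp only: power_Suc2 mult.assoc)
  qed simp
  then have hm: "h * q ^ m = 0" using mn by simp
  have "\<exists>s. k * q ^ i = q2 ^ i * k + s * h" for i
  proof (induction i)
    case 0 show ?case by (rule exI[of _ 0]) simp
  next
    case (Suc i)
    then obtain s where s: "k * q ^ i = q2 ^ i * k + s * h" by blast
    have "k * q ^ Suc i = k * q ^ i * q" by (simp only: power_Suc2 mult.assoc)
    also have "\<dots> = q2 ^ i * (k * q) + s * (h * q)" unfolding s by (simp add: algebra_simps)
    also have "k * q = q2 * k + k * x * h" using kq q2' by simp
    also have "h * q = q1 * h" using hq q1 by simp
    also have "q2 ^ i * (q2 * k + k * x * h) + s * (q1 * h)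
        = q2 ^ Suc i * k + (q2 ^ i * k * x + s * q1) * h"
      by (simp only: power_Suc2 mult.assoc distrib_left distrib_right add.assoc)
    finally show ?case by blast
  qed
  from this[of n] obtain s where "k * q ^ n = s * h" using mn by auto
  then have "k * q ^ (n + m) = s * (h * q ^ m)" by (simp only: power_add flip: mult.assoc)
  then have kz: "k * q ^ (n + m) = 0" using hm by simp
  have "h * q ^ (m + n) = h * q ^ m * q ^ n" by (simp only: power_add mult.assoc)
  then have hz: "h * q ^ (n + m) = 0" using hm by (simp add: add.commute)
  have "q1 * g = q1" "q2 * g = q2" "k * x * h * g = k * x * h"
    using q1 q2' k h by (metis mult.assoc)+
  then have "q = q * g" unfolding q_def by (simp add: distrib_right)
  \<comment> \<open>The extra factor comes from \<open>q = q * g\<close>, which brings in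
    \<open>g = h + k\<close> so that both rows can be used.\<close>
  then have "q ^ Suc (n + m) = q * (h * q ^ (n + m) + k * q ^ (n + m))"
    unfolding power_Suc by (metis k(6) mult.assoc distrib_right)
  then have "q ^ Suc (n + m) = 0" unfolding kz hz by simp
  then show ?thesis unfolding q_def k_def nilp_def by blast
qed

context semisimple_ring
begin

text \<open>Invariant left ideals inside \<open>Sg\<close> become idempotents of the corner: a right
  identity of \<open>L\<close>, multiplied by \<open>g\<close>, generates \<open>L\<close>, and
  invariance of \<open>L\<close> under \<open>x\<close> reads
  \<open>h * x = h * x * h\<close>.\<close>

lemma invariant_idempotent:
  fixes g x :: 'a
  assumes "left_ideal L" "\<And>y. y \<in> L \<Longrightarrow> y * x \<in> L" "\<And>y. y \<in> L \<Longrightarrow> y * g = y" "g * g = g"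
  obtains h where "h \<in> L" "idem h" "g * h = h" "h * g = h" "h * x = h * x * h" 
    "\<And>y. y \<in> L \<Longrightarrow> y * h = y"
proof -
  obtain a where a: "a \<in> L" "\<And>y. y \<in> L \<Longrightarrow> y * a = y"
    using left_ideal_generator assms(1) by blast
  define h where "h = g * a"
  have hL: "h \<in> L" unfolding h_def using left_idealD(3)[OF assms(1)] a by blast
  have yh: "y * h = y" if "y \<in> L" for y
    using that a(2) assms(3) unfolding h_def by (metis mult.assoc)
  show thesis
  proof (rule that[OF hL _ _ _ _ yh])
    show "idem h" using yh hL by (simp add: idem_def)
    show "g * h = h" unfolding h_def using assms(4) by (metis mult.assoc)
    show "h * g = h" using assms(3) hL .
    show "h * x = h * x * h" using yh assms(2) hL by simp
  qed
qed

end

context gwnc_semisimple_ring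
begin

text \<open>The rows \<open>e * x ^ i\<close> span an \<open>x\<close>-invariant left ideal of
  \<open>Sg\<close> that contains \<open>e\<close>, and by \<open>irr\<close> it is all of
  \<open>Sg\<close>. Expanding \<open>g\<close> in these rows yields the dual vectors
  \<open>u i\<close>, and the first dependence among the rows yields the companion coefficients
  \<open>c i\<close>.\<close>

lemma cyclic_basis:
  fixes g x e :: 'a
  assumes g: "idem g" and x: "g * x = x" "x * g = x"
    and e: "primitive e" "g * e = e" "e * g = e" "e + e = 0"
    and irr: "\<And>h. idem h \<Longrightarrow> g * h = h \<Longrightarrow> h * g = h \<Longrightarrow> h * x = h * x * h \<Longrightarrow> h = 0 \<or> h = g"
  obtains n u c where
    "n > 0" "g = (\<Sum>i<n. u i * x ^ i)" "\<And>i. u i * e = u i" "\<And>i. g * u i = u i"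
    "\<And>i j. i < n \<Longrightarrow> j < n \<Longrightarrow> e * x ^ j * u i = (if i = j then e else 0)"
    "e * x ^ n = (\<Sum>i<n. c i * x ^ i)" "\<And>i. c i = 0 \<or> c i = e"
proof -
  have gg: "g * g = g" and ee: "e * e = e" using g e by (simp_all add: idem_def primitive_def)
  have e0: "e \<noteq> 0" using e by (simp add: primitive_def)
  have exg: "e * x ^ j * g = e * x ^ j" for j
    by (cases j) (simp_all add: x e power_Suc2 mult.assoc del: power_Suc)
  \<comment> \<open>Since \<open>- e = e\<close>, the corner of \<open>e\<close> is the field with
    two elements.\<close>
  have F2: "e * a * e = 0 \<or> e * a * e = e" for a
  proof -
    have "- e = e" using e(4) by (simp add: neg_eq_iff_add_eq_0)
    then show ?thesis using primitive_corner[OF e(1), of "e * a * e"] ee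
      by (metis mult.assoc)
  qed
  have F2': "c = 0 \<or> c = e" if "e * c = c" "c * e = c" for c
    using F2[of c] that by simp
  define L where "L k = {\<Sum>i<k. s i * e * x ^ i |s. True}" for k
  have L: "left_ideal (L k)" for k
    unfolding left_ideal_def
  proof (intro conjI ballI allI)
    show "0 \<in> L k" unfolding L_def by (auto intro!: exI[of _ "\<lambda>_. 0"])
    fix y z assume "y \<in> L k" "z \<in> L k"
    then obtain s t where st: "y = (\<Sum>i<k. s i * e * x ^ i)" "z = (\<Sum>i<k. t i * e * x ^ i)"
      unfolding L_def by auto
    have "y + z = (\<Sum>i<k. (s i + t i) * e * x ^ i)"
      unfolding st by (simp add: distrib_right sum.distrib)
    then show "y + z \<in> L k" unfolding L_def by (auto intro!: exI[of _ "\<lambda>i. s i + t i"])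
  next
    fix r y assume "y \<in> L k"
    then obtain s where st: "y = (\<Sum>i<k. s i * e * x ^ i)" unfolding L_def by auto
    have "r * y = (\<Sum>i<k. (r * s i) * e * x ^ i)"
      unfolding st by (simp add: sum_distrib_left mult.assoc)
    then show "r * y \<in> L k" unfolding L_def by (auto intro!: exI[of _ "\<lambda>i. r * s i"])
  qed
  have Lgen: "r * e * x ^ i \<in> L k" if "i < k" for r i k
    unfolding L_def
  proof (intro CollectI exI conjI)
    show "r * e * x ^ i = (\<Sum>j<k. (if j = i then r else 0) * e * x ^ j)"
      using that by (simp add: if_distrib if_distribR sum.delta cong: if_cong)
  qed simp
  have Lsub: "y \<in> L k" if gen: "\<And>i. i < m \<Longrightarrow> e * x ^ i \<in> L k" and "y \<in> L m" for y k m
  proof -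
    obtain s where "y = (\<Sum>i<m. s i * e * x ^ i)" using \<open>y \<in> L m\<close> unfolding L_def by auto
    moreover have "(\<Sum>i<j. s i * e * x ^ i) \<in> L k" if "j \<le> m" for j
      using that
    proof (induction j)
      case (Suc j)
      have "s j * (e * x ^ j) \<in> L k" using left_idealD(3)[OF L gen] Suc by simp
      then show ?case using Suc left_idealD(2)[OF L] by (simp add: mult.assoc)
    qed (simp add: left_idealD(1)[OF L])
    ultimately show ?thesis by simp
  qed
  have Lmono: "L k \<subseteq> L m" if "k \<le> m" for k m
    using Lsub[of k m] Lgen[of _ m 1] that by auto
  have Lcoef: "\<exists>c. (\<forall>i. c i = 0 \<or> c i = e) \<and> e * y = (\<Sum>i<k. c i * x ^ i)"
    if yL: "y \<in> L k" for y k
  proof -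
    obtain s where s: "y = (\<Sum>i<k. s i * e * x ^ i)" using yL unfolding L_def by auto
    then have "e * y = (\<Sum>i<k. (e * s i * e) * x ^ i)" by (simp add: sum_distrib_left mult.assoc)
    then show ?thesis using F2 by (intro exI[of _ "\<lambda>i. e * s i * e"]) auto
  qed
  \<comment> \<open>The union of the chain has a right identity lying in one of its members, so the
    chain stabilises and some \<open>e * x ^ k\<close> depends on the earlier rows.\<close>
  have "left_ideal (\<Union>(range L))"
  proof (rule left_ideal_Union_chain)
    show "M \<subseteq> M' \<or> M' \<subseteq> M" if "M \<in> range L" "M' \<in> range L" for M M'
      using that Lmono nat_le_linear by blast
  qed (use L in auto)
  then obtain a where a: "a \<in> \<Union>(range L)" "\<And>y. y \<in> \<Union>(range L) \<Longrightarrow> y * a = y"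
    using left_ideal_generator by blast
  then obtain k where "a \<in> L k" by auto
  have "e * x ^ k \<in> \<Union>(range L)" using Lgen[of k "Suc k" 1] by auto
  then have "e * x ^ k * a = e * x ^ k" by (rule a(2))
  then have ex: "e * x ^ k \<in> L k" using left_idealD(3)[OF L \<open>a \<in> L k\<close>] by metis
  define n where "n = (LEAST n. e * x ^ n \<in> L n)"
  have n: "e * x ^ n \<in> L n" unfolding n_def by (rule LeastI[of _ k]) (rule ex)
  have nmin: "e * x ^ m \<notin> L m" if "m < n" for m using that not_less_Least unfolding n_def by blast
  have "n > 0"
  proof (rule ccontr)
    assume "\<not> n > 0"
    then have "e \<in> L 0" using n by simp
    then show False using e0 by (simp add: L_def)
  qed
  obtain c where c: "e * x ^ n = (\<Sum>i<n. c i * x ^ i)" "\<And>i. c i = 0 \<or> c i = e"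
    using Lcoef[OF n] ee by (metis mult.assoc)
  \<comment> \<open>A relation with top coefficient \<open>e\<close> would put
    \<open>e * x ^ m\<close> into \<open>L m\<close>, against the minimality of
    \<open>n\<close>.\<close>
  have indep: "\<forall>i<m. b i = 0" if "(\<Sum>i<m. b i * x ^ i) = 0" "\<And>i. b i = 0 \<or> b i = e" "m \<le> n" for b m
    using that
  proof (induction m)
    case (Suc m)
    have "b m = 0"
    proof (rule ccontr)
      assume "b m \<noteq> 0"
      then have "b m = e" using Suc.prems by blast
      then have "e * x ^ m = - (\<Sum>i<m. b i * x ^ i)" using Suc.prems(1)
        by (simp add: eq_neg_iff_add_eq_0 add.commute)
      also have "\<dots> = (\<Sum>i<m. (- b i) * e * x ^ i)"
        unfolding sum_negf[symmetric]
      proof (rule sum.cong[OF refl])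
        fix i
        have "b i * e = b i" using Suc.prems(2)[of i] ee by auto
        then show "- (b i * x ^ i) = - b i * e * x ^ i" by simp
      qed
      finally have "e * x ^ m \<in> L m" unfolding L_def by (auto intro!: exI[of _ "\<lambda>i. - b i"])
      then show False using nmin Suc.prems by simp
    qed
    then show ?case using Suc by (simp add: less_Suc_eq)
  qed simp
  have "g \<in> L n"
  proof -
    have Lx: "y * x \<in> L n" if yL: "y \<in> L n" for y
    proof -
      obtain s where "y = (\<Sum>i<n. s i * e * x ^ i)" using yL unfolding L_def by auto
      then have "y * x = (\<Sum>i<n. s i * e * x ^ Suc i)"
        by (simp add: sum_distrib_right power_commutes mult.assoc)
      moreover have "(\<Sum>i<j. s i * e * x ^ Suc i) \<in> L n" if "j \<le> n" for j
        using that
      proof (induction j)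
        case (Suc j)
        have "e * x ^ Suc j \<in> L n"
        proof (cases "Suc j = n")
          case True
          then show ?thesis using n by simp
        next
          case False
          then show ?thesis using Lgen[of "Suc j" n 1] Suc by simp
        qed
        then have "s j * (e * x ^ Suc j) \<in> L n" by (rule left_idealD(3)[OF L])
        then show ?case using Suc left_idealD(2)[OF L] by (simp add: mult.assoc)
      qed (simp add: left_idealD(1)[OF L])
      ultimately show ?thesis by simp
    qed
    have Lg: "y * g = y" if yL: "y \<in> L n" for y
    proof -
      obtain s where s: "y = (\<Sum>i<n. s i * e * x ^ i)" using yL unfolding L_def by auto
      show ?thesis unfolding s sum_distrib_right
      proof (rule sum.cong[OF refl])
        fix i show "s i * e * x ^ i * g = s i * e * x ^ i"
          using arg_cong[OF exg[of i], of "\<lambda>y. s i * y"] by (simp add: mult.assoc)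
      qed
    qed
    obtain h where h: "h \<in> L n" "idem h" "g * h = h" "h * g = h" "h * x = h * x * h"
      "\<And>y. y \<in> L n \<Longrightarrow> y * h = y"
      using invariant_idempotent[OF L Lx Lg gg] by metis
    have "e * h = e" using h(6)[OF Lgen[of 0 n 1]] \<open>n > 0\<close> by simp
    then have "h \<noteq> 0" using e0 by auto
    then show ?thesis using irr[OF h(2-5)] h(1) by auto
  qed
  then obtain s where s: "g = (\<Sum>i<n. s i * e * x ^ i)" unfolding L_def by auto
  define u where "u i = g * s i * e" for i
  have u1: "g = (\<Sum>i<n. u i * x ^ i)"
  proof -
    have "g = g * (\<Sum>i<n. s i * e * x ^ i)" using gg s by simp
    then show ?thesis by (simp add: u_def sum_distrib_left mult.assoc)
  qed
  have u2: "u i * e = u i" "g * u i = u i" for i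
    by (simp_all add: u_def mult.assoc ee mult_absorb_left[OF gg])
  \<comment> \<open>Expand \<open>e * x ^ j * g = e * x ^ j\<close> by the formula for
    \<open>g\<close>; independence of the rows then allows comparison of coefficients.\<close>
  have u3: "e * x ^ j * u i = (if i = j then e else 0)" if "i < n" "j < n" for i j
  proof -
    define b where "b i = e * x ^ j * u i - (if i = j then e else 0)" for i
    have "(\<Sum>i<n. b i * x ^ i) = e * x ^ j * g - (\<Sum>i<n. if i = j then e * x ^ i else 0)"
      unfolding b_def left_diff_distrib sum_subtractf u1
      by (simp add: sum_distrib_left mult.assoc if_distrib if_distribR cong: if_cong)
    also have "\<dots> = 0" using that exg by (simp add: sum.delta)
    finally have z: "(\<Sum>i<n. b i * x ^ i) = 0" .
    have "b i = 0 \<or> b i = e" for i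
    proof (rule F2')
      show "e * b i = b i" "b i * e = b i"
        by (auto simp: b_def algebra_simps ee mult_absorb_left[OF ee] u2)
    qed
    then have "b i = 0" using indep[OF z] that by blast
    then show ?thesis by (simp add: b_def)
  qed
  show thesis using that[OF \<open>n > 0\<close> u1 u2 u3 c] by blast
qed

end

subsection \<open>Nil-clean corners of characteristic two\<close>

context gwnc_semisimple_ring
begin

text \<open>
  The rows \<open>e x\<^sup>i\<close> with \<open>i < n\<close> are a basis with dual basis \<open>u i\<close>, in which \<open>x\<close> is a companion matrix.
  If its trace \<open>c (n - 1)\<close> is 1, then its last row is an idempotent and the rest is a nilpotent shift.
  If the trace is 0 and \<open>n \<ge> 3\<close>, the last basis vector is replaced by \<open>w\<close>, which puts 1 in the last
  two diagonal entries; \<open>\<gamma>\<close> makes the last row vanish in column \<open>n - 2\<close>, so that these two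
  rows form an idempotent of rank 2.
\<close>

lemma cyclic_nil_clean:
  fixes g x e :: 'a
  assumes g: "idem g" "g + g = 0" and x: "g * x = x" "x * g = x"
    and e: "primitive e" "g * e = e" "e * g = e"
    and irr: "\<And>h. idem h \<Longrightarrow> g * h = h \<Longrightarrow> h * g = h \<Longrightarrow> h * x = h * x * h \<Longrightarrow> h = 0 \<or> h = g"
  shows "\<exists>f. idem f \<and> nilp (x - f) \<and> g * f = f \<and> f * g = f"
proof -
  have gg: "g * g = g" and ee: "e * e = e" using g e by (simp_all add: idem_def primitive_def)
  have two: "v + v = 0" if "g * v = v" for v
    using g(2) that by (metis distrib_right mult_zero_left)
  have e2: "e + e = 0" using two e by simp
  obtain n u c where n: "n > 0" and gu: "g = (\<Sum>i<n. u i * x ^ i)"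
    and u: "\<And>i. u i * e = u i" "\<And>i. g * u i = u i"
    and dual: "\<And>i j. i < n \<Longrightarrow> j < n \<Longrightarrow> e * x ^ j * u i = (if i = j then e else 0)"
    and exn: "e * x ^ n = (\<Sum>i<n. c i * x ^ i)" and c: "\<And>i. c i = 0 \<or> c i = e"
    using cyclic_basis[OF g(1) x e e2 irr] by blast
  have ce: "c i * e = c i" "e * c i = c i" for i using c[of i] ee by auto
  have exg: "e * x ^ j * g = e * x ^ j" for j
    by (cases j) (simp_all add: x e power_Suc2 mult.assoc del: power_Suc)
  have gex: "g * (e * y) = e * y" for y using e by (simp flip: mult.assoc)
  \<comment> \<open>Nilpotency is tested on the basis rows: if \<open>q ^ N\<close> kills all of
    them, then \<open>g * q ^ N = 0\<close>, and one more factor \<open>q = q * g\<close> gives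
    zero.\<close>
  have nilI: "nilp q" if "\<And>j. j < n \<Longrightarrow> e * x ^ j * q ^ N = 0" "g * q = q" "q * g = q" for q N
  proof -
    have "g * q ^ N = (\<Sum>i<n. u i * (e * x ^ i * q ^ N))"
      unfolding gu sum_distrib_right by (rule sum.cong) (simp_all add: u flip: mult.assoc)
    also have "\<dots> = 0" using that(1) by simp
    finally have "q ^ Suc N = 0" unfolding power_Suc using that(3) by (metis mult.assoc mult_zero_right)
    then show ?thesis unfolding nilp_def by blast
  qed
  have esuc: "e * x ^ j * x = e * x ^ Suc j" for j by (simp only: power_Suc2 mult.assoc)
  \<comment> \<open>The split is by the trace \<open>c (n - 1)\<close>. The construction for trace 0
    needs three rows, so \<open>n = 1\<close> and \<open>n = 2\<close> are done by hand.\<close>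
  consider (one) m where "n = Suc m" "c m = e" | (1) "n = 1" "c 0 = 0"
    | (2) "n = 2" "c 1 = 0" | (3) m where "n = m + 3" "c (m + 2) = 0"
  proof -
    obtain m where m: "n = Suc m" using n by (cases n) auto
    show thesis
    proof (cases "c m = e")
      case True then show thesis using that(1) m by blast
    next
      case False
      then have cm: "c m = 0" using c[of m] by blast
      consider "m = 0" | "m = 1" | k where "m = k + 2"
        by (metis One_nat_def add_2_eq_Suc' not0_implies_Suc)
      then show thesis
      proof cases
        case 1 then show ?thesis using that(2) cm m by simp
      next
        case 2 then show ?thesis using that(3) cm m by simp
      next
        case 3 then show ?thesis using that(4)[of k] cm m by simp
      qed
    qed
  qed
  then show ?thesis
  proof cases
    case (one m)
    \<comment> \<open>This is the last row of the companion matrix: it sends row \<open>m\<close> to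
      \<open>e * x ^ n\<close> and all other rows to 0.\<close>
    define f where "f = u m * (e * x ^ n)"
    have ef: "e * x ^ j * f = (if j = m then e * x ^ n else 0)" if "j < n" for j
      unfolding f_def using dual[of m j] that one by (auto simp: ee simp flip: mult.assoc)
    have "e * x ^ n * u m = (\<Sum>i<n. c i * (e * x ^ i * u m))"
      unfolding exn sum_distrib_right by (rule sum.cong) (simp_all add: ce flip: mult.assoc)
    also have "\<dots> = (\<Sum>i<n. if i = m then c i * e else 0)"
      by (rule sum.cong) (use one dual in auto)
    also have "\<dots> = e" using one ee by simp
    finally have "f * f = f" unfolding f_def by (metis mult.assoc u(1))
    moreover have gf: "g * f = f" "f * g = f"
      unfolding f_def using u exg by (simp_all add: mult.assoc) (metis mult.assoc u(2))
    moreover have "nilp (x - f)"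
    proof (rule nilI[where N = n])
      fix j assume j: "j < n"
      \<comment> \<open>The difference \<open>x - f\<close> moves each row to the next and kills row
        \<open>m\<close>.\<close>
      have "e * x ^ (m - k) * (x - f) ^ Suc k = 0" if "k \<le> m" for k
        using that
      proof (induction k)
        case 0
        then show ?case using ef[of m] one by (simp add: right_diff_distrib esuc del: power_Suc)
      next
        case (Suc k)
        have "e * x ^ (m - Suc k) * (x - f) = e * x ^ Suc (m - Suc k)"
          using ef[of "m - Suc k"] one Suc.prems less_imp_neq[of "m - Suc k" m] by (simp add: right_diff_distrib esuc del: power_Suc)
        then have "e * x ^ (m - Suc k) * (x - f) ^ Suc (Suc k)
            = e * x ^ Suc (m - Suc k) * (x - f) ^ Suc k"
          by (simp only: power_Suc[of "x - f" "Suc k"] flip: mult.assoc)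
        then show ?case using Suc by (simp add: Suc_diff_Suc del: power_Suc)
      qed
      from this[of "m - j"] have z: "e * x ^ j * (x - f) ^ Suc (m - j) = 0" using j one by simp
      have "n = Suc (m - j) + j" using j one by simp
      then have "(x - f) ^ n = (x - f) ^ Suc (m - j) * (x - f) ^ j" by (metis power_add)
      then show "e * x ^ j * (x - f) ^ n = 0" using z by (metis mult.assoc mult_zero_left)
    qed (simp_all add: algebra_simps x gf)
    ultimately show ?thesis by (auto simp: idem_def)
  next
    case 1
    have "e * x = 0" using exn 1 by simp
    moreover have "x = u 0 * (e * x)" using x gu 1 u(1) by (simp flip: mult.assoc)
    ultimately have "x = 0" by simp
    then show ?thesis by (intro exI[of _ 0]) (auto simp: idem_def nilp_def intro: exI[of _ 1])
  next
    case 2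
    have exx: "e * x * x = c 0" using exn 2
      by (simp add: numeral_2_eq_2 mult.assoc)
    from c[of 0] show ?thesis
    proof
      assume "c 0 = 0"
      have "nilp x"
      proof (rule nilI[where N = 2])
        fix j assume "j < n"
        have "e * x * x * x = 0" using exx \<open>c 0 = 0\<close> by simp
        moreover have "j = 0 \<or> j = 1" using \<open>j < n\<close> 2 by auto
        ultimately show "e * x ^ j * x ^ 2 = 0"
          using exx \<open>c 0 = 0\<close> by (auto simp: power2_eq_square mult.assoc)
      qed (simp_all add: x)
      then show ?thesis by (intro exI[of _ 0]) (simp add: idem_def)
    next
      \<comment> \<open>Here \<open>x * x\<close> acts as the identity, so in characteristic 2 the
        square of \<open>x - g\<close> vanishes and \<open>f = g\<close> works.\<close>
      assume "c 0 = e"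
      have "nilp (x - g)"
      proof (rule nilI[where N = 2])
        fix j assume "j < n"
        then have j: "j = 0 \<or> j = 1" using 2 by auto
        have sq: "(x - g) ^ 2 = x * x + g - (x + x)"
          by (simp add: power2_eq_square algebra_simps x gg)
        have "x + x = 0" using two x by simp
        moreover have "e * (x * x) = e" using exx \<open>c 0 = e\<close> by (simp add: mult.assoc)
        moreover have "e * (x * (x * x)) = e * x" using exx \<open>c 0 = e\<close> by (simp flip: mult.assoc)
        moreover have "e * x + e * x = 0" using two gex by blast
        ultimately show "e * x ^ j * (x - g) ^ 2 = 0"
          using j e2 unfolding sq by (auto simp: algebra_simps x e)
      qed (simp_all add: algebra_simps x gg)
      then show ?thesis using g gg by (intro exI[of _ g]) simp
    qed
  next
    case (3 m)
    define \<gamma> where "\<gamma> = c (m + 1) + e"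
    define y where "y = e * x ^ (m + 1) + \<gamma> * x ^ m"
    define w where "w = e * x ^ (m + 2) + y"
    define z where "z = w * x + y"
    \<comment> \<open>The aim is \<open>e * x ^ (m + 1) * f = y\<close> and
      \<open>w * f = w * x\<close>. The image \<open>z\<close> of the row
      \<open>e * x ^ (m + 2) = w - y\<close> is determined by these, as \<open>y * f = y\<close> and
      signs do not matter.\<close>
    define f where "f = u (m + 1) * y + u (m + 2) * z"
    have \<gamma>: "\<gamma> * e = \<gamma>" "e * \<gamma> = \<gamma>" by (simp_all add: \<gamma>_def distrib_left distrib_right ce ee)
    have ey: "e * y = y" unfolding y_def by (simp add: distrib_left ee \<gamma> flip: mult.assoc)
    have ew: "e * w = w" unfolding w_def by (simp add: distrib_left ee ey flip: mult.assoc)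
    have ez: "e * z = z" unfolding z_def by (simp add: distrib_left ey ew flip: mult.assoc)
    have ef: "e * x ^ j * f = (if j = m + 1 then y else if j = m + 2 then z else 0)" if "j < n" for j
      unfolding f_def using dual[of "m + 1" j] dual[of "m + 2" j] that 3
      by (simp add: distrib_left ee ey ez flip: mult.assoc)
    have ef0: "e * x ^ j * f = 0" if "j \<le> m" for j using ef[of j] that 3 by simp
    have ev: "v * y + v * y = 0" if "e * v = v" for v y
      using two[of "v * y"] gex[of "v * y"] that by (simp flip: mult.assoc)
    have yy: "y + y = 0" using ev[of y 1] ey by simp
    have yf: "y * f = y"
    proof -
      have "\<gamma> * x ^ m * f = \<gamma> * (e * x ^ m * f)" using \<gamma> by (simp flip: mult.assoc)
      also have "\<dots> = 0" using ef0[of m] by simp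
      finally show ?thesis using ef[of "m + 1"] 3 unfolding y_def by (simp add: distrib_right y_def)
    qed
    define B where "B = (\<Sum>i<m + 1. c i * x ^ i)"
    have Bf: "B * f = 0"
      unfolding B_def sum_distrib_right
    proof (rule sum.neutral, rule ballI)
      fix i assume "i \<in> {..<m + 1}"
      then have "e * x ^ i * f = 0" using ef0[of i] by simp
      then show "c i * x ^ i * f = 0" using ce(1)[of i] by (metis mult.assoc mult_zero_right)
    qed
    \<comment> \<open>The choice of \<open>\<gamma>\<close> makes the coefficient of
      \<open>x ^ (m + 1)\<close> equal to \<open>e\<close>, whatever \<open>c (m + 1)\<close> is.
      This is what yields \<open>w * x * f = w * x\<close>.\<close>
    have wx: "w * x = B + e * x ^ (m + 1) + e * x ^ (m + 2)"
    proof -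
      have "w * x = e * x ^ (m + 3) + e * x ^ (m + 2) + \<gamma> * x ^ (m + 1)"
        unfolding w_def y_def
        by (simp only: distrib_right mult.assoc power_Suc2[symmetric] add.assoc) (simp add: numeral_3_eq_3)
      also have "e * x ^ (m + 3) = B + c (m + 1) * x ^ (m + 1)"
        using exn 3 unfolding B_def by (simp add: numeral_3_eq_3)
      finally have "w * x = B + (c (m + 1) + c (m + 1)) * x ^ (m + 1) + e * x ^ (m + 1) + e * x ^ (m + 2)"
        by (simp add: \<gamma>_def distrib_right algebra_simps)
      moreover have "c (m + 1) + c (m + 1) = 0" using ev[of "c (m + 1)" 1] ce by simp
      ultimately show ?thesis by simp
    qed
    have wf: "w * f = w * x"
    proof -
      have "w * f = z + y" unfolding w_def using ef[of "m + 2"] 3 yf by (simp add: distrib_right)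
      then show ?thesis unfolding z_def using yy by (simp add: add.assoc)
    qed
    have "w * x * f = y + z" unfolding wx using ef[of "m + 1"] ef[of "m + 2"] 3 Bf
      by (simp add: distrib_right)
    also have "\<dots> = w * x" unfolding z_def using yy by (simp add: add.left_commute)
    finally have wxf: "w * x * f = w * x" .
    have zf: "z * f = z" unfolding z_def using wxf yf by (simp add: distrib_right)
    have "f * f = u (m + 1) * (y * f) + u (m + 2) * (z * f)"
      by (subst f_def) (simp add: distrib_right mult.assoc)
    then have "f * f = f" unfolding yf zf f_def[symmetric] .
    moreover have gf: "g * f = f" "f * g = f"
    proof -
      show "g * f = f" unfolding f_def by (simp add: distrib_left u flip: mult.assoc)
      have \<gamma>g: "\<gamma> * x ^ m * g = \<gamma> * x ^ m" using \<gamma> exg[of m] by (metis mult.assoc)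
      have yg: "y * g = y" unfolding y_def using exg[of "m + 1"] \<gamma>g by (simp add: distrib_right)
      have "z * g = z" unfolding z_def using yg x by (simp add: distrib_right mult.assoc)
      with yg show "f * g = f" unfolding f_def by (simp add: distrib_right mult.assoc)
    qed
    moreover have "nilp (x - f)"
    proof -
      define q where "q = x - f"
      have wq: "w * q = 0" using wf by (simp add: q_def right_diff_distrib)
      \<comment> \<open>Under \<open>q\<close> the rows up to \<open>m + 1\<close> shift upwards,
        row \<open>m + 1\<close> goes to \<open>w\<close>, and \<open>w\<close> goes to 0.\<close>
      have low: "e * x ^ (m + 1 - k) * q ^ (k + 2) = 0" if "k \<le> m + 1" for k
        using that
      proof (induction k)
        case 0
        have "e * x ^ (m + 1) * q = e * x ^ (m + 2) - y"
          using ef[of "m + 1"] 3 esuc[of "m + 1"] by (simp add: q_def right_diff_distrib)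
        also have "\<dots> = w" unfolding w_def using yy by (simp add: algebra_simps)
        finally show ?case using wq by (simp add: power2_eq_square flip: mult.assoc)
      next
        case (Suc k)
        have "e * x ^ (m + 1 - Suc k) * q = e * x ^ Suc (m + 1 - Suc k)"
          using ef0[of "m + 1 - Suc k"]
          by (simp add: q_def right_diff_distrib esuc del: power_Suc)
        then have "e * x ^ (m + 1 - Suc k) * q ^ (Suc k + 2)
            = e * x ^ Suc (m + 1 - Suc k) * q ^ (k + 2)"
          by (simp only: power_Suc[of q "k + 2"] add_Suc flip: mult.assoc)
        also have "Suc (m + 1 - Suc k) = m + 1 - k" using Suc.prems by simp
        finally show ?case using Suc by simp
      qed
      have low': "e * x ^ j * q ^ (m + 3) = 0" if "j \<le> m + 1" for j
      proof -
        have "m + 3 = (m + 1 - j + 2) + j" using that by simp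
        then have "q ^ (m + 3) = q ^ (m + 1 - j + 2) * q ^ j" by (metis power_add)
        then show ?thesis using low[of "m + 1 - j"] that by (simp flip: mult.assoc)
      qed
      show ?thesis unfolding q_def[symmetric]
      proof (rule nilI[where N = "m + 4"])
        fix j assume j: "j < n"
        have m4: "m + 4 = Suc (m + 3)" by simp
        have S: "q ^ (m + 4) = q ^ (m + 3) * q" unfolding m4 by (rule power_Suc2)
        have S': "q ^ (m + 4) = q * q ^ (m + 3)" unfolding m4 by (rule power_Suc)
        show "e * x ^ j * q ^ (m + 4) = 0"
        proof (cases "j \<le> m + 1")
          case True
          then show ?thesis unfolding S using low' by (simp flip: mult.assoc)
        next
          case False
          then have "j = m + 2" using j 3 by simp
          have "e * x ^ (m + 2) = w - y" by (simp add: w_def)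
          moreover have "w * q ^ (m + 4) = 0" unfolding S' using wq by (simp flip: mult.assoc)
          moreover have "y * q ^ (m + 4) = 0"
          proof -
            have "\<gamma> * x ^ m * q ^ (m + 3) = \<gamma> * (e * x ^ m * q ^ (m + 3))"
              using \<gamma> by (simp flip: mult.assoc)
            then have "\<gamma> * x ^ m * q ^ (m + 3) = 0" using low'[of m] by simp
            then have "y * q ^ (m + 3) = 0" unfolding y_def using low'[of "m + 1"]
              by (simp add: distrib_right)
            then show ?thesis unfolding S by (simp flip: mult.assoc)
          qed
          ultimately show ?thesis unfolding \<open>j = m + 2\<close> by (simp add: left_diff_distrib)
        qed
      qed (simp_all add: q_def algebra_simps x gf)
    qed
    ultimately show ?thesis by (auto simp: idem_def)
  qed
qed

text \<open>Induction on \<open>g\<close>. A proper invariant \<open>h\<close> makes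
  \<open>x\<close> block triangular, and the idempotents found for the two diagonal blocks add up to
  one for \<open>x\<close>; without such an \<open>h\<close> the cyclic case applies.\<close>

lemma nil_clean_corner:
  fixes g x :: 'a
  assumes "idem g" "g + g = 0" "g * x = x" "x * g = x"
  shows "\<exists>f. idem f \<and> nilp (x - f) \<and> g * f = f \<and> f * g = f"
  using assms
proof (induction g arbitrary: x rule: wf_induct_rule[OF wf_idem_less])
  case (1 g)
  have gg: "g * g = g" using 1 by (simp add: idem_def)
  show ?case
  proof (cases "\<exists>h. idem h \<and> g * h = h \<and> h * g = h \<and> h * x = h * x * h \<and> h \<noteq> 0 \<and> h \<noteq> g")
    case True
    then obtain h where h: "idem h" "g * h = h" "h * g = h" "h * x = h * x * h" "h \<noteq> 0" "h \<noteq> g"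
      by blast
    have hh: "h * h = h" using h by (simp add: idem_def)
    define k where "k = g - h"
    have k: "k * k = k" "h * k = 0" "k * h = 0" "g * k = k" "k * g = k"
      unfolding k_def by (simp_all add: algebra_simps h gg hh)
    have less: "(h, g) \<in> idem_less" "(k, g) \<in> idem_less"
      using h 1 k by (auto simp: idem_less_def idem_def k_def)
    have two: "h + h = 0" "k + k = 0"
      using 1(3) h(2) k(4) by (metis distrib_right mult_zero_left)+
    have "h * (h * x * h) = h * x * h" "h * x * h * h = h * x * h"
      using hh by (metis mult.assoc)+
    then obtain f1 where f1: "idem f1" "nilp (h * x * h - f1)" "h * f1 = f1" "f1 * h = f1"
      using 1(1)[OF less(1) h(1) two(1)] by blast
    have "k * (k * x * k) = k * x * k" "k * x * k * k = k * x * k"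
      using k by (metis mult.assoc)+
    then obtain f2 where f2: "idem f2" "nilp (k * x * k - f2)" "k * f2 = f2" "f2 * k = f2"
      using 1(1)[OF less(2) _ two(2)] k by (metis idem_def)
    have f12: "f1 * f2 = 0" "f2 * f1 = 0"
      using f1(3,4) f2(3,4) k(2,3) by (metis mult.assoc mult_zero_left mult_zero_right)+
    define q1 q2 where "q1 = h * x * h - f1" and "q2 = k * x * k - f2"
    have "nilp (q1 + q2 + (g - h) * x * h)"
    proof (rule nilp_lower_triangular)
      show "nilp q1" "nilp q2" using f1 f2 by (simp_all add: q1_def q2_def)
      show "h * q1 = q1" "q1 * h = q1"
        by (simp_all add: q1_def algebra_simps f1 hh mult_absorb_left[OF hh])
      show "(g - h) * q2 = q2" "q2 * (g - h) = q2" unfolding k_def[symmetric]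
        by (simp_all add: q2_def right_diff_distrib left_diff_distrib mult.assoc f2 k mult_absorb_left[OF k(1)])
    qed (use h hh gg in simp_all)
    also have "q1 + q2 + (g - h) * x * h = x - (f1 + f2)"
    proof -
      have "k * x * k = x - h * x - k * x * h"
        using h(3,4) 1(4,5) by (simp add: k_def algebra_simps)
      then show ?thesis using h(4) by (simp add: q1_def q2_def k_def)
    qed
    finally have "nilp (x - (f1 + f2))" .
    moreover have "idem (f1 + f2)"
      using f1(1) f2(1) f12 by (simp add: idem_def algebra_simps)
    moreover have "g * f1 = f1" "f1 * g = f1" "g * f2 = f2" "f2 * g = f2"
      using f1(3,4) f2(3,4) h(2,3) k(4,5) by (metis mult.assoc)+
    ultimately show ?thesis by (intro exI[of _ "f1 + f2"]) (simp add: distrib_left distrib_right)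
  next
    case irr: False
    show ?thesis
    proof (cases "g = 0")
      case True
      then show ?thesis using 1 by (intro exI[of _ 0]) (auto simp: idem_def nilp_def intro: exI[of _ 1])
    next
      case False
      obtain e where "primitive e" "g * e = e" "e * g = e"
        using exists_primitive[OF 1(2) False] by blast
      then show ?thesis using cyclic_nil_clean[of g x e] 1 irr by blast
    qed
  qed
qed

end

subsection \<open>Trace on the part of characteristic three\<close>

lemma numeral_commute: "(numeral w :: 'a::ring_1) * x = x * numeral w"
  by (metis mult_of_nat_commute of_nat_numeral)

context semisimple_ring
begin

lemma primitive_decomposition:
  assumes "idem (g :: 'a)"
  shows "\<exists>E. finite E \<and> (\<forall>e\<in>E. primitive e \<and> g * e = e \<and> e * g = e)
    \<and> pairwise (\<lambda>e e'. e * e' = 0) E \<and> \<Sum>E = g"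
  using assms
proof (induction g rule: wf_induct_rule[OF wf_idem_less])
  case (1 g)
  have gg: "g * g = g" using 1 by (simp add: idem_def)
  consider "g = 0" | "primitive g" | h where "idem h" "g * h = h" "h * g = h" "h \<noteq> 0" "h \<noteq> g"
    using 1(2) unfolding primitive_def by blast
  then show ?case
  proof cases
    case 1 then show ?thesis by (intro exI[of _ "{}"]) simp
  next
    case 2 then show ?thesis using gg by (intro exI[of _ "{g}"]) simp
  next
    case (3 h)
    have hh: "h * h = h" using 3 by (simp add: idem_def)
    define k where "k = g - h"
    have k: "k * k = k" "h * k = 0" "k * h = 0" "g * k = k" "k * g = k"
      unfolding k_def by (simp_all add: algebra_simps 3 gg hh)
    have less: "(h, g) \<in> idem_less" "(k, g) \<in> idem_less"
      using 3 1 k by (auto simp: idem_less_def idem_def k_def)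
    obtain A where A: "finite A" "\<And>e. e \<in> A \<Longrightarrow> primitive e \<and> h * e = e \<and> e * h = e"
      "pairwise (\<lambda>e e'. e * e' = 0) A" "\<Sum>A = h"
      using 1(1)[OF less(1) 3(1)] by blast
    obtain B where B: "finite B" "\<And>e. e \<in> B \<Longrightarrow> primitive e \<and> k * e = e \<and> e * k = e"
      "pairwise (\<lambda>e e'. e * e' = 0) B" "\<Sum>B = k"
      using 1(1)[OF less(2)] k by (auto simp: idem_def)
    have AB: "a * b = 0" "b * a = 0" if "a \<in> A" "b \<in> B" for a b
      using A(2)[OF that(1)] B(2)[OF that(2)] k(2,3)
      by (metis mult.assoc mult_zero_left mult_zero_right)+
    \<comment> \<open>The decomposition is a sum over a set, so the two families must be disjoint; a
      common element would be a nonzero idempotent of square zero.\<close>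
    have "A \<inter> B = {}"
    proof (rule ccontr)
      assume "A \<inter> B \<noteq> {}"
      then obtain a where "a \<in> A" "a \<in> B" by blast
      then have "a * a = 0" "primitive a" using AB A by blast+
      then show False by (auto simp: primitive_def idem_def)
    qed
    then have "\<Sum>(A \<union> B) = g" using A B by (simp add: sum.union_disjoint k_def)
    moreover have "pairwise (\<lambda>e e'. e * e' = 0) (A \<union> B)"
      using A(3) B(3) AB unfolding pairwise_def by blast
    moreover have "primitive e \<and> g * e = e \<and> e * g = e" if "e \<in> A \<union> B" for e
    proof (cases "e \<in> A")
      case True
      then show ?thesis using A(2)[OF True] 3 by (metis mult.assoc)
    next
      case False
      then show ?thesis using B(2)[of e] that k(4,5) by (metis mult.assoc UnE)
    qed
    ultimately show ?thesis using A(1) B(1) by (intro exI[of _ "A \<union> B"]) blast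
  qed
qed

end

section \<open>Primitive corners of characteristic three as copies of the field with three
  elements\<close>

definition scale3 :: "3 \<Rightarrow> 'a::ring_1 \<Rightarrow> 'a" where
  "scale3 k e = (if k = 0 then 0 else if k = 1 then e else - e)"

text \<open>Intended for \<open>a\<close> in {0, e, -e}, where it inverts \<open>scale3\<close>;
  every other argument also gets the value -1.\<close>

definition coeff3 :: "'a::ring_1 \<Rightarrow> 'a \<Rightarrow> 3" where
  "coeff3 e a = (if a = 0 then 0 else if a = e then 1 else - 1)"

lemma scale3_simps [simp]: "scale3 0 e = 0" "scale3 1 e = e" "scale3 (-1) e = - e"
  by (simp_all add: scale3_def)

lemma three_torsion:
  fixes e :: "'a::ring_1"
  assumes "e + e + e = 0" shows "e + e = - e" "- e = e \<longleftrightarrow> e = 0" "e = - e \<longleftrightarrow> e = 0"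
proof -
  show *: "e + e = - e" using assms by (simp add: eq_neg_iff_add_eq_0)
  show "- e = e \<longleftrightarrow> e = 0"
  proof
    assume "- e = e"
    then have "e + e = e" using * by simp
    then show "e = 0" by simp
  qed simp
  then show "e = - e \<longleftrightarrow> e = 0" by metis
qed

context gwnc_semisimple_ring
begin

text \<open>For a primitive \<open>e\<close> the corner element \<open>e + e\<close> is 0,
  \<open>e\<close> or \<open>- e\<close>. The middle value is impossible, so \<open>2 e = 0\<close>
  or \<open>3 e = 0\<close>, hence \<open>6 e = 0\<close>; now sum over a decomposition of
  1.\<close>

lemma six_eq_zero: "(6 :: 'a) = 0"
proof -
  obtain E :: "'a set" where E: "\<And>e. e \<in> E \<Longrightarrow> primitive e" "\<Sum>E = 1"
    using primitive_decomposition[of 1] by (auto simp: idem_def)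
  have "6 * e = 0" if "e \<in> E" for e
  proof -
    have e: "primitive e" "e * e = e" "e \<noteq> 0" using E(1)[OF that] by (simp_all add: primitive_def idem_def)
    have "e + e = 0 \<or> e + e = e \<or> e + e = - e"
      using primitive_corner[OF e(1), of "e + e"] e(2) by (simp add: distrib_left distrib_right)
    then have "e + e = 0 \<or> e + e + e = 0" using e(3) by (auto simp: add_eq_0_iff2)
    moreover have "6 * e = (e + e) + (e + e) + (e + e)"
    proof -
      have "(6 :: 'a) = 1 + 1 + (1 + 1) + (1 + 1)" by simp
      then show ?thesis by (simp only: distrib_right mult_1)
    qed
    moreover have "(e + e) + (e + e) + (e + e) = (e + e + e) + (e + e + e)" by (simp add: add.assoc)
    ultimately show ?thesis by fastforce
  qed
  then have "6 * \<Sum>E = 0" by (simp add: sum_distrib_left)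
  then show ?thesis using E by simp
qed

lemma scale3_coeff3:
  assumes "primitive (e :: 'a)" "e * a = a" "a * e = a"
  shows "scale3 (coeff3 e a) e = a"
  using primitive_corner[OF assms] by (auto simp: coeff3_def)

lemma coeff3_scale3:
  assumes "primitive (e :: 'a)" "e + e + e = 0"
  shows "coeff3 e (scale3 k e) = k"
  using Z3_cases[of k] three_torsion[OF assms(2)] assms(1)
  by (auto simp: coeff3_def primitive_def)

lemma scale3_add:
  assumes "(e :: 'a) + e + e = 0" shows "scale3 (k + l) e = scale3 k e + scale3 l e"
proof -
  have "(2 :: 3) = -1" "(-2 :: 3) = 1" by simp_all
  then have "scale3 2 e = - e" "scale3 (-2) e = e" by (simp_all only: scale3_simps)
  moreover have "e + e = - e" "- e - e = e"
    using three_torsion(1)[OF assms] by (simp, metis minus_add_distrib minus_minus diff_conv_add_uminus)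
  ultimately show ?thesis
    using Z3_cases[of k] Z3_cases[of l] by auto
qed

lemma scale3_mult:
  assumes "idem (e :: 'a)" shows "scale3 k e * scale3 l e = scale3 (k * l) e"
  using Z3_cases[of k] Z3_cases[of l] assms by (auto simp: idem_def)

lemma coeff3_add:
  assumes e: "primitive (e :: 'a)" "e + e + e = 0"
    and ab: "e * a = a" "a * e = a" "e * b = b" "b * e = b"
  shows "coeff3 e (a + b) = coeff3 e a + coeff3 e b"
proof -
  have "a + b = scale3 (coeff3 e a + coeff3 e b) e"
    using scale3_add[OF e(2)] scale3_coeff3[OF e(1)] ab by simp
  then show ?thesis using coeff3_scale3[OF e] by metis
qed

lemma coeff3_sum:
  assumes e: "primitive (e :: 'a)" "e + e + e = 0"
    and a: "\<And>i. i \<in> I \<Longrightarrow> e * a i = a i" "\<And>i. i \<in> I \<Longrightarrow> a i * e = a i"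
  shows "coeff3 e (\<Sum>i\<in>I. a i) = (\<Sum>i\<in>I. coeff3 e (a i))"
  using a
proof (induction I rule: infinite_finite_induct)
  case (insert i I)
  then have "coeff3 e (a i + (\<Sum>i\<in>I. a i)) = coeff3 e (a i) + coeff3 e (\<Sum>i\<in>I. a i)"
    by (intro coeff3_add[OF e]) (auto simp: sum_distrib_left sum_distrib_right intro!: sum.cong)
  then show ?case using insert by simp
qed (simp_all add: coeff3_def)

lemma coeff3_mult:
  assumes e: "primitive (e :: 'a)" "e + e + e = 0"
    and ab: "e * a = a" "a * e = a" "e * b = b" "b * e = b"
  shows "coeff3 e (a * b) = coeff3 e a * coeff3 e b"
proof -
  have "a * b = scale3 (coeff3 e a * coeff3 e b) e"
    using scale3_mult[of e] e scale3_coeff3[OF e(1)] ab by (metis primitive_def)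
  then show ?thesis using coeff3_scale3[OF e] by metis
qed

end

text \<open>The central idempotent \<open>d\<close> cuts out the part of characteristic 3, and
  \<open>E\<close> plays the role of the diagonal matrix units there. The locale is later used with
  \<open>d = 4\<close>.\<close>

locale char3_part = gwnc_semisimple_ring T for T :: "'a::ring_1 itself" +
  fixes E :: "'a set" and d :: 'a
  assumes finite_E: "finite E" and primitive_E: "\<And>e. e \<in> E \<Longrightarrow> primitive e"
    and orthogonal_E: "\<And>e e'. e \<in> E \<Longrightarrow> e' \<in> E \<Longrightarrow> e \<noteq> e' \<Longrightarrow> e * e' = 0"
    and sum_E: "\<Sum>E = d" and central: "\<And>x. d * x = x * d"
    and torsion: "d + d + d = 0"
begin

definition tr :: "'a \<Rightarrow> 3" where "tr x = (\<Sum>e\<in>E. coeff3 e (e * x * e))"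

lemma idem_E: "e \<in> E \<Longrightarrow> e * e = e"
  using primitive_E by (simp add: primitive_def idem_def)

lemma absorb_E: "e \<in> E \<Longrightarrow> e * (e * x) = e * x"
  using idem_E by (simp flip: mult.assoc)

lemma d_E: "e \<in> E \<Longrightarrow> d * e = e" "e \<in> E \<Longrightarrow> e * d = e"
proof -
  assume e: "e \<in> E"
  have "d * e = (\<Sum>e'\<in>E. if e' = e then e else 0)"
    unfolding sum_E[symmetric] sum_distrib_right
    by (rule sum.cong) (use e orthogonal_E idem_E in auto)
  then show "d * e = e" using e finite_E by simp
  then show "e * d = e" using central by simp
qed

lemma torsion_corner: "d * x = x \<Longrightarrow> x + x + x = 0"
  using torsion by (metis distrib_right mult_zero_left)

lemma torsion_E: "e \<in> E \<Longrightarrow> e + e + e = 0"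
  using torsion_corner d_E by blast

lemma d_idem: "d * d = d"
proof -
  have "d * d = (\<Sum>e\<in>E. d * e)" by (simp add: sum_E flip: sum_distrib_left)
  also have "\<dots> = d" using d_E sum_E by simp
  finally show ?thesis .
qed

lemma corner_E: "e \<in> E \<Longrightarrow> e * (e * x * e) = e * x * e" "e \<in> E \<Longrightarrow> e * x * e * e = e * x * e"
  using idem_E by (metis mult.assoc)+

lemma tr_add: "tr (x + y) = tr x + tr y"
proof -
  have "coeff3 e (e * (x + y) * e) = coeff3 e (e * x * e) + coeff3 e (e * y * e)" if "e \<in> E" for e
    using coeff3_add[OF primitive_E[OF that] torsion_E[OF that], of "e * x * e" "e * y * e"]
      corner_E[OF that] by (simp add: distrib_left distrib_right)
  then show ?thesis by (simp add: tr_def sum.distrib)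
qed

lemma tr_0 [simp]: "tr 0 = 0" by (simp add: tr_def coeff3_def)

lemma tr_minus: "tr (- x) = - tr x"
  using tr_add[of x "- x"] by (simp add: eq_neg_iff_add_eq_0 add.commute)

lemma tr_sum: "tr (\<Sum>i\<in>I. f i) = (\<Sum>i\<in>I. tr (f i))"
  by (induction I rule: infinite_finite_induct) (simp_all add: tr_add)

text \<open>For entries \<open>u\<close> in \<open>eSe'\<close> and \<open>v\<close> in
  \<open>e'Se\<close>, the products \<open>u * v\<close> and \<open>v * u\<close> are multiples
  \<open>k\<close> of \<open>e\<close> and \<open>k'\<close> of \<open>e'\<close>. Comparing
  \<open>(u * v) * u\<close> with \<open>u * (v * u)\<close> gives \<open>k = k'\<close>, unless
  \<open>u = 0\<close>, when both are 0.\<close>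

lemma coeff3_swap:
  assumes "e \<in> E" "e' \<in> E"
  shows "coeff3 e (e * x * e' * y * e) = coeff3 e' (e' * y * e * x * e')"
proof (rule ccontr)
  assume neq: "\<not> ?thesis"
  define u v where "u = e * x * e'" and "v = e' * y * e"
  have uv: "e * x * e' * y * e = u * v" "e' * y * e * x * e' = v * u"
    unfolding u_def v_def by (simp_all add: mult.assoc absorb_E idem_E assms)
  have eu: "e * u = u" "u * e' = u" "e' * v = v" "v * e = v"
    unfolding u_def v_def by (simp_all add: mult.assoc absorb_E idem_E assms)
  define k where "k = coeff3 e (u * v)"
  define k' where "k' = coeff3 e' (v * u)"
  have "k \<noteq> k'" using neq uv by (simp add: k_def k'_def)
  have "scale3 k e = u * v" unfolding k_def
    by (intro scale3_coeff3 primitive_E assms) (use eu in \<open>metis mult.assoc\<close>)+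
  moreover have "scale3 k' e' = v * u" unfolding k'_def
    by (intro scale3_coeff3 primitive_E assms) (use eu in \<open>metis mult.assoc\<close>)+
  ultimately have eq: "scale3 k e * u = u * scale3 k' e'" by (simp add: mult.assoc)
  have "d * u = u" using eu(1) d_E(1)[OF assms(1)] by (metis mult.assoc)
  then have "- u = u \<longleftrightarrow> u = 0" "u = - u \<longleftrightarrow> u = 0"
    by (rule three_torsion(2,3)[OF torsion_corner])+
  with eq \<open>k \<noteq> k'\<close> Z3_cases[of k] Z3_cases[of k'] eu have "u = 0" by auto
  then show False using \<open>k \<noteq> k'\<close> by (simp add: k_def k'_def coeff3_def)
qed

text \<open>Inserting \<open>d\<close>, the sum of \<open>E\<close>, between the factors turns both
  traces into double sums that agree term by term by \<open>coeff3_swap\<close>. Only one factor has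
  to lie in the \<open>d\<close>-part.\<close>

lemma tr_commute:
  assumes "d * x = x" shows "tr (x * y) = tr (y * x)"
proof -
  have "tr (x * y) = (\<Sum>e\<in>E. \<Sum>e'\<in>E. coeff3 e (e * x * e' * y * e))"
    unfolding tr_def
  proof (rule sum.cong[OF refl])
    fix e assume e: "e \<in> E"
    have "x * y = x * d * y" using assms central by simp
    then have "e * (x * y) * e = (\<Sum>e'\<in>E. e * x * e' * y * e)"
      unfolding sum_E[symmetric] by (simp add: sum_distrib_left sum_distrib_right mult.assoc)
    then show "coeff3 e (e * (x * y) * e) = (\<Sum>e'\<in>E. coeff3 e (e * x * e' * y * e))"
      using coeff3_sum[OF primitive_E[OF e] torsion_E[OF e], of E "\<lambda>e'. e * x * e' * y * e"]
      by (simp add: mult.assoc idem_E e absorb_E)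
  qed
  also have "\<dots> = (\<Sum>e\<in>E. \<Sum>e'\<in>E. coeff3 e' (e' * y * e * x * e'))"
    by (intro sum.cong refl coeff3_swap)
  also have "\<dots> = (\<Sum>e'\<in>E. \<Sum>e\<in>E. coeff3 e' (e' * y * e * x * e'))"
    by (rule sum.swap)
  also have "\<dots> = tr (y * x)"
    unfolding tr_def
  proof (rule sum.cong[OF refl])
    fix e assume e: "e \<in> E"
    have "y * x = y * d * x" using assms by (simp add: mult.assoc)
    then have "e * (y * x) * e = (\<Sum>e'\<in>E. e * y * e' * x * e)"
      unfolding sum_E[symmetric] by (simp add: sum_distrib_left sum_distrib_right mult.assoc)
    then show "(\<Sum>e'\<in>E. coeff3 e (e * y * e' * x * e)) = coeff3 e (e * (y * x) * e)"
      using coeff3_sum[OF primitive_E[OF e] torsion_E[OF e], of E "\<lambda>e'. e * y * e' * x * e"]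
      by (simp add: mult.assoc idem_E e absorb_E)
  qed
  finally show ?thesis .
qed

lemma three_Z3: "(k::3) + k + k = 0"
  using Z3_cases[of k] by auto

text \<open>The mixed terms of the cube form two triples of cyclic rotations. Each triple has three
  equal traces, and their sum is 0 modulo 3.\<close>

lemma tr_cube_add:
  assumes "d * x = x" "tr (x * x * x) = tr x" "d * y = y" "tr (y * y * y) = tr y"
  shows "tr ((x + y) * (x + y) * (x + y)) = tr (x + y)"
proof -
  have "tr (x * x * y) = tr (y * x * x)" "tr (x * y * x) = tr (y * x * x)"
    "tr (x * y * y) = tr (y * y * x)" "tr (y * x * y) = tr (y * y * x)"
    using tr_commute[of x "x * y"] tr_commute[of y "x * x"] tr_commute[of x "y * x"]
      tr_commute[of x "y * y"] tr_commute[of y "x * y"] tr_commute[of y "y * x"] assms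
    by (simp_all add: mult.assoc)
  moreover have "(x + y) * (x + y) * (x + y) = x * x * x + (x * x * y + x * y * x + y * x * x)
      + (x * y * y + y * x * y + y * y * x) + y * y * y"
    by (simp add: distrib_left distrib_right algebra_simps)
  ultimately show ?thesis using assms three_Z3 by (simp add: tr_add)
qed

text \<open>Since \<open>(x + y)\<^sup>3 - x\<^sup>3 - y\<^sup>3\<close> is a sum of commutators in characteristic 3, it suffices to check the matrix
  units; the consequence is that nilpotent elements have trace 0.\<close>

lemma tr_cube:
  assumes "d * x = x" shows "tr (x * x * x) = tr x"
proof -
  have sum: "d * (\<Sum>i\<in>I. f i) = (\<Sum>i\<in>I. f i)
      \<and> tr ((\<Sum>i\<in>I. f i) * (\<Sum>i\<in>I. f i) * (\<Sum>i\<in>I. f i)) = tr (\<Sum>i\<in>I. f i)"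
    if "\<And>i. i \<in> I \<Longrightarrow> d * f i = f i \<and> tr (f i * f i * f i) = tr (f i)" for f and I :: "'i set"
    using that
  proof (induction I rule: infinite_finite_induct)
    case (insert i I)
    then show ?case using tr_cube_add[of "f i" "sum f I"] by (simp add: distrib_left)
  qed simp_all
  \<comment> \<open>A diagonal entry is 0 or a sign times \<open>e\<close> and equals its own cube.
    An off-diagonal entry has square zero, and its trace vanishes by commutation.\<close>
  have unit: "tr (e * x * e' * (e * x * e') * (e * x * e')) = tr (e * x * e')"
    if e: "e \<in> E" "e' \<in> E" for e e'
  proof (cases "e = e'")
    case True
    have "e * x * e = 0 \<or> e * x * e = e \<or> e * x * e = - e"
      using primitive_corner[OF primitive_E[OF e(1)]] corner_E[OF e(1)] by blast
    then have "(e * x * e) * (e * x * e) * (e * x * e) = e * x * e"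
      using idem_E[OF e(1)] by auto
    then show ?thesis using True by simp
  next
    case False
    then have "e' * e = 0" using orthogonal_E e by blast
    then have "e' * (e * z) = 0" for z by (simp flip: mult.assoc)
    moreover have "tr (e * (x * e')) = tr (x * e' * e)"
      using tr_commute[of e "x * e'"] d_E e by simp
    ultimately show ?thesis using \<open>e' * e = 0\<close> by (simp add: mult.assoc)
  qed
  have dx: "d * (e * z) = e * z" if "e \<in> E" for e z using d_E[OF that] by (simp flip: mult.assoc)
  have "x = d * x * d" using assms central by simp
  also have "\<dots> = (\<Sum>e\<in>E. \<Sum>e'\<in>E. e * x * e')"
    unfolding sum_E[symmetric] by (simp only: sum_distrib_right) (simp only: sum_distrib_left)
  also have "\<dots> = (\<Sum>(e, e')\<in>E \<times> E. e * x * e')" by (rule sum.cartesian_product)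
  finally have x: "x = (\<Sum>p\<in>E \<times> E. fst p * x * snd p)" by (simp add: case_prod_beta)
  show ?thesis
    using sum[of "E \<times> E" "\<lambda>p. fst p * x * snd p"] unit dx unfolding x[symmetric]
    by (auto simp: mult.assoc)
qed

text \<open>By \<open>tr_cube\<close> the trace does not change when \<open>q\<close> is raised to
  the powers \<open>3 ^ k\<close>, which are eventually zero.\<close>

lemma tr_nilp:
  assumes "d * q = q" "nilp q" shows "tr q = 0"
proof -
  obtain n where n: "q ^ n = 0" using assms by (auto simp: nilp_def)
  have dq: "d * q ^ m = q ^ m" if "m > 0" for m
    using that assms(1) by (cases m) (simp_all flip: mult.assoc)
  have "tr (q ^ (3 ^ k)) = tr q" for k
  proof (induction k)
    case (Suc k)
    have "q ^ (3 ^ Suc k) = q ^ 3 ^ k * q ^ 3 ^ k * q ^ 3 ^ k"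
      by (simp add: power_mult[of q _ 3] power3_eq_cube mult.commute[of 3] flip: power_mult)
    then show ?case using tr_cube[of "q ^ 3 ^ k"] dq Suc by simp
  qed simp
  moreover have "n \<le> 3 ^ n" by (simp add: less_imp_le_nat power_gt_expt)
  then have "q ^ 3 ^ n = 0" using n by (metis le_add_diff_inverse mult_zero_left power_add)
  ultimately show ?thesis by (metis tr_0)
qed

text \<open>Some \<open>e\<close> in \<open>E\<close> has \<open>f * e \<noteq> 0\<close>, and
  simplicity makes the two idempotents equivalent: \<open>u * v = f\<close> and
  \<open>v * u = e\<close>. Hence \<open>f\<close> has the trace of \<open>e\<close>.\<close>

lemma tr_primitive:
  assumes f: "primitive f" "d * f = f" shows "tr f = 1"
proof -
  have ff: "f * f = f" "f \<noteq> 0" using f by (simp_all add: primitive_def idem_def)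
  have "f = (\<Sum>e\<in>E. f * e)" using f central sum_E by (simp flip: sum_distrib_left)
  then obtain e where e: "e \<in> E" "f * e \<noteq> 0" using ff by (metis sum.neutral)
  obtain y where y: "y * (f * e) = e" "e * y = y"
    using primitive_left_inverse[OF primitive_E[OF e(1)], of "f * e"] e idem_E by (metis mult.assoc)
  define u v where "u = f * e" and "v = y * f"
  have vu: "v * u = e" unfolding u_def v_def using y ff by (metis mult.assoc)
  have "e * v = v" unfolding v_def using y by (simp flip: mult.assoc)
  then have "u * v * (u * v) = u * v" using vu by (metis mult.assoc)
  moreover have "f * (u * v) = u * v" "u * v * f = u * v"
    unfolding u_def v_def using ff by (metis mult.assoc)+
  moreover have "u * v \<noteq> 0"
  proof
    assume "u * v = 0"
    then have "v * (u * v) * u = 0" by simp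
    then have "e * e = 0" using vu by (metis mult.assoc)
    then show False using e idem_E primitive_E unfolding primitive_def by metis
  qed
  ultimately have "u * v = f" using f unfolding primitive_def idem_def by blast
  then have "tr f = tr (u * v)" by simp
  also have "\<dots> = tr e" using tr_commute[of u v] vu f unfolding u_def by (simp flip: mult.assoc)
  also have "\<dots> = (\<Sum>e'\<in>E. if e' = e then 1 else 0)"
    unfolding tr_def
  proof (rule sum.cong[OF refl])
    fix e' assume e': "e' \<in> E"
    show "coeff3 e' (e' * e * e') = (if e' = e then 1 else 0)"
      using orthogonal_E[OF e' e(1)] idem_E[OF e(1)] primitive_E[OF e(1)]
      by (auto simp: coeff3_def primitive_def)
  qed
  also have "\<dots> = 1" using e finite_E by simp
  finally show ?thesis .
qed

end

subsection \<open>Classification of semisimple GWNC rings\<close>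

context semisimple_ring
begin

text \<open>Right multiplication by \<open>a\<close> cannot embed two independent rows into the
  simple module \<open>Se\<close>: both images generate \<open>Se\<close>, so some nontrivial
  combination of the rows is sent to 0.\<close>

lemma rank_one_bound:
  assumes e: "primitive (e :: 'a)" and y: "y1 \<noteq> 0" "y2 \<noteq> 0"
    and indep: "\<And>s t. s * y1 = t * y2 \<Longrightarrow> s * y1 = 0"
    and ye: "y1 * a * e = y1 * a" "y2 * a * e = y2 * a"
    and inj: "\<And>s t. (s * y1 - t * y2) * a = 0 \<Longrightarrow> s * y1 - t * y2 = 0"
  shows False
proof -
  have "y1 * a \<noteq> 0" "y2 * a \<noteq> 0" using inj[of 1 0] inj[of 0 "-1"] y by auto
  then obtain s t where st: "s * (y1 * a) = e" "t * (y2 * a) = e"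
    using primitive_left_inverse[OF e] ye by metis
  then have "(s * y1 - t * y2) * a = 0" by (simp add: left_diff_distrib mult.assoc)
  then have "s * y1 = t * y2" using inj by (simp flip: eq_iff_diff_eq_0)
  then have "s * y1 = 0" using indep by blast
  then have "e = 0" using st by (metis mult.assoc mult_zero_left)
  then show False using e by (simp add: primitive_def)
qed

text \<open>One step of Gaussian elimination with pivot \<open>f\<^sub>1 a e\<^sub>1\<close>.\<close>

lemma rank_two_bound_pivot:
  assumes e: "primitive (e1 :: 'a)" "primitive e2"
    and a: "a * e1 + a * e2 = a" "e1 * e2 = 0" "e1 * e1 = e1" "e2 * e2 = e2" "e2 * e1 = 0"
    and f: "f1 * f1 = f1" "f2 * f2 = f2" "f3 * f3 = f3" "f1 * f2 = 0" "f1 * f3 = 0"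
      "f2 * f3 = 0" "f3 * f2 = 0" "f2 \<noteq> 0" "f3 \<noteq> 0"
    and F: "f1 * F = f1" "f2 * F = f2" "f3 * F = f3"
    and inj: "\<And>x. x * F = x \<Longrightarrow> x * a = 0 \<Longrightarrow> x = 0"
    and pivot: "f1 * a * e1 \<noteq> 0"
  shows False
proof -
  obtain s where s: "s * (f1 * a * e1) = e1"
    using primitive_left_inverse[OF e(1), of "f1 * a * e1"] pivot a(3) by (metis mult.assoc)
  \<comment> \<open>From the row \<open>f\<close> this subtracts the multiple of the pivot row
    \<open>f1\<close> that clears the \<open>e1\<close> component of \<open>f * a\<close>; the new
    row is mapped into \<open>Se2\<close>.\<close>
  define y where "y f = f - f * a * e1 * s * f1" for f
  have yf: "y f2 * f2 = f2" "y f3 * f3 = f3" "y f2 * f3 = 0" "y f3 * f2 = 0"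
    using f by (simp_all add: y_def left_diff_distrib mult.assoc)
  have yF: "y f2 * F = y f2" "y f3 * F = y f3"
    using F by (simp_all add: y_def left_diff_distrib mult.assoc)
  have ye: "y f * a * e2 = y f * a" for f
  proof -
    have "y f * a * e1 = f * a * e1 - f * a * e1 * (s * (f1 * a * e1))"
      by (simp add: y_def left_diff_distrib mult.assoc)
    also have "\<dots> = 0" unfolding s by (simp add: mult.assoc a)
    finally have "y f * a * e1 = 0" .
    moreover have "y f * a = y f * a * e1 + y f * a * e2"
      using a(1) by (metis distrib_left mult.assoc)
    ultimately show ?thesis by simp
  qed
  show False
  proof (rule rank_one_bound[OF e(2), of "y f2" "y f3" a])
    show "y f2 \<noteq> 0" "y f3 \<noteq> 0" using yf f by auto
    show "s * y f2 = 0" if "s * y f2 = t * y f3" for s t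
    proof -
      \<comment> \<open>Right multiplication by \<open>f2\<close> recovers the coefficient on the
        left and annihilates \<open>y f3\<close>.\<close>
      have "s * f2 = s * y f2 * f2" using yf by (simp add: mult.assoc)
      also have "\<dots> = 0" unfolding that using yf by (simp add: mult.assoc)
      finally show ?thesis unfolding y_def
        by (simp add: right_diff_distrib flip: mult.assoc)
    qed
    show "s * y f2 - t * y f3 = 0" if "(s * y f2 - t * y f3) * a = 0" for s t
      by (rule inj[OF _ that]) (simp add: left_diff_distrib mult.assoc yF)
  qed (rule ye)+
qed

text \<open>Right multiplication by \<open>a\<close> embeds the span of \<open>F\<close> into
  \<open>Se1 + Se2\<close>. Among three rows, either one has a nonzero \<open>e1\<close> component
  and serves as pivot, or two rows already map into \<open>Se2\<close>.\<close>

lemma rank_two_bound: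
  assumes e: "primitive (e1 :: 'a)" "primitive e2"
    and a: "a * e1 + a * e2 = a" "e1 * e2 = 0" "e2 * e1 = 0"
    and F: "finite F" "\<And>f. f \<in> F \<Longrightarrow> primitive f" "pairwise (\<lambda>e e'. e * e' = 0) F"
    and inj: "\<And>x. x * \<Sum>F = x \<Longrightarrow> x * a = 0 \<Longrightarrow> x = 0"
  shows "card F < 3"
proof (rule ccontr)
  assume "\<not> card F < 3"
  then obtain S where S: "S \<subseteq> F" "card S = 3" using obtain_subset_with_card_n by (metis not_less)
  then obtain f1 f2 f3 where S': "S = {f1, f2, f3}" "f1 \<noteq> f2" "f1 \<noteq> f3" "f2 \<noteq> f3"
    by (metis card_3_iff)
  have ee: "e1 * e1 = e1" "e2 * e2 = e2" using e by (simp_all add: primitive_def idem_def)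
  have fF: "f * \<Sum>F = f" if "f \<in> F" for f
  proof -
    have "f * \<Sum>F = (\<Sum>f'\<in>F. if f' = f then f else 0)"
      unfolding sum_distrib_left
      by (rule sum.cong) (use F that in \<open>auto simp: pairwise_def primitive_def idem_def\<close>)
    then show ?thesis using that F(1) by simp
  qed
  have mem: "f1 \<in> F" "f2 \<in> F" "f3 \<in> F" using S S' by auto
  have ff: "f * f = f" "f \<noteq> 0" if "f \<in> F" for f using F(2)[OF that] by (simp_all add: primitive_def idem_def)
  have orth: "f * f' = 0" if "f \<in> F" "f' \<in> F" "f \<noteq> f'" for f f'
    using F(3) that by (auto simp: pairwise_def)
  have no_pivot: "f * a * e1 = 0" if "f \<in> F" "f' \<in> F" "f'' \<in> F" "f \<noteq> f'" "f \<noteq> f''" "f' \<noteq> f''" for f f' f''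
    using rank_two_bound_pivot[OF e a(1,2) ee a(3), of f f' f'' "\<Sum>F"] inj fF ff orth that by metis
  have "f1 * a * e1 = 0" "f2 * a * e1 = 0"
    using no_pivot[of f1 f2 f3] no_pivot[of f2 f1 f3] mem S' by auto
  then have ae: "f1 * a * e2 = f1 * a" "f2 * a * e2 = f2 * a"
    using a(1) by (metis add_0 distrib_left mult.assoc)+
  show False
  proof (rule rank_one_bound[OF e(2) _ _ _ ae])
    show "f1 \<noteq> 0" "f2 \<noteq> 0" using ff mem by auto
    show "s * f1 = 0" if "s * f1 = t * f2" for s t
    proof -
      have "s * f1 = s * f1 * f1" using ff mem by (simp add: mult.assoc)
      also have "\<dots> = 0" unfolding that using orth mem S' by (simp add: mult.assoc)
      finally show ?thesis .
    qed
    show "s * f1 - t * f2 = 0" if "(s * f1 - t * f2) * a = 0" for s t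
      by (rule inj[OF _ that]) (simp add: left_diff_distrib mult.assoc fF mem)
  qed
qed

end

section \<open>Two orthogonal primitive idempotents in characteristic three\<close>

context char3_part
begin

text \<open>Cut down to the \<open>d\<close>-part, \<open>a = q' + f'\<close>. Traces give
  \<open>tr f' = 1 - 1 - 0 = 0\<close>, while \<open>f'\<close> has rank at most 2 because
  \<open>a\<close> is injective on its rows. So \<open>f' = 0\<close> and \<open>a\<close> would be
  nilpotent, although \<open>a * a\<close> fixes \<open>e1\<close>.\<close>

lemma difference_not_nil_clean:
  assumes e: "primitive e1" "primitive e2" "d * e1 = e1" "d * e2 = e2" "e1 * e2 = 0" "e2 * e1 = 0"
    and qf: "e1 - e2 = q + f" "nilp q" "idem f"
  shows False
proof -
  define a where "a = e1 - e2"
  define q' where "q' = q * d"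
  define f' where "f' = f * d"
  have ee: "e1 * e1 = e1" "e2 * e2 = e2" using e by (simp_all add: primitive_def idem_def)
  have "a = a * d" using e central by (simp add: a_def left_diff_distrib)
  then have aq: "a = q' + f'" using qf(1) by (simp add: a_def q'_def f'_def distrib_right)
  have "q' ^ n = q ^ n * d ^ n" for n unfolding q'_def
    by (induction n) (simp_all, metis central mult.assoc power_commuting_commutes)
  then have q': "nilp q'" "d * q' = q'"
    using qf(2) central d_idem unfolding nilp_def q'_def by (metis mult_zero_left, metis mult.assoc)
  have f'f': "f' * f' = f'" "d * f' = f'"
    using qf(3) central d_idem unfolding f'_def idem_def by (metis mult.assoc)+
  have "tr a = 0" using tr_primitive e tr_add[of e1 "- e2"] tr_minus[of e2] by (simp add: a_def)
  then have trf: "tr f' = 0" using tr_nilp[OF q'(2,1)] tr_add[of q' f'] aq by simp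
  obtain F where F: "finite F" "\<And>f. f \<in> F \<Longrightarrow> primitive f \<and> f' * f = f \<and> f * f' = f"
    "pairwise (\<lambda>e e'. e * e' = 0) F" "\<Sum>F = f'"
    using primitive_decomposition[of f'] f'f' by (auto simp: idem_def)
  have inj: "x = 0" if "x * \<Sum>F = x" "x * a = 0" for x
  proof -
    have "x * a = x * q' + x * f'" unfolding aq by (rule distrib_left)
    \<comment> \<open>On a row fixed by \<open>f'\<close> and killed by \<open>a\<close>, the
      nilpotent \<open>q'\<close> acts as -1, so the row is zero.\<close>
    then have "x * q' = - x" using that F(4) by (simp add: add_eq_0_iff2)
    then have "x * q' ^ n = (- 1) ^ n * x" for n
      by (induction n) (simp_all add: power_commutes flip: mult.assoc)
    moreover obtain n where "q' ^ n = 0" using q' nilp_def by blast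
    ultimately have "(- 1) ^ n * x = 0" by (metis mult_zero_right)
    then show ?thesis by (simp add: minus_one_power_iff split: if_splits)
  qed
  have "card F < 3"
  proof (rule rank_two_bound[OF e(1,2) _ e(5,6) F(1) _ F(3)])
    show "a * e1 + a * e2 = a" using e ee by (simp add: a_def left_diff_distrib)
  qed (use F inj in auto)
  moreover have "tr f' = of_nat (card F)"
  proof -
    have "tr f' = (\<Sum>f\<in>F. tr f)" using tr_sum[of "\<lambda>x. x" F] F(4) by simp
    also have "\<dots> = (\<Sum>f\<in>F. 1)"
      by (rule sum.cong[OF refl], rule tr_primitive) (use F(2) f'f' in \<open>metis mult.assoc\<close>)+
    finally show ?thesis by simp
  qed
  \<comment> \<open>The cardinality is below 3 and divisible by 3.\<close>
  ultimately have "card F = 0" using trf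
    by (cases "card F = 0"; cases "card F = 1"; cases "card F = 2") auto
  then have "a = q'" using F aq by auto
  then obtain n where n: "a ^ n = 0" using q' nilp_def by blast
  have aaa: "a * a = e1 + e2" "a * a * e1 = e1"
    using e ee by (simp_all add: a_def algebra_simps)
  have "(a * a) ^ k * e1 = e1" for k
    by (induction k) (simp_all add: aaa power_commutes mult.assoc, metis aaa mult.assoc)
  moreover have "(a * a) ^ n = a ^ n * a ^ n"
    by (metis power_add mult_2 power2_eq_square power_mult)
  ultimately have "e1 = 0" using n by (metis mult_zero_left)
  then show False using e by (simp add: primitive_def)
qed

text \<open>Otherwise the nonzero element \<open>1 - (e1 + e2)\<close> annihilates
  \<open>e1 - e2\<close>, which is then a nonunit, so GWNC applies to it. The form
  \<open>q - f\<close> is reduced to the other one by exchanging \<open>e1\<close> and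
  \<open>e2\<close>.\<close>

lemma two_primitives:
  assumes e: "primitive e1" "primitive e2" "d * e1 = e1" "d * e2 = e2" "e1 * e2 = 0" "e2 * e1 = 0"
  shows "e1 + e2 = 1"
proof (rule ccontr)
  assume ne: "e1 + e2 \<noteq> 1"
  have ee: "e1 * e1 = e1" "e2 * e2 = e2" using e by (simp_all add: primitive_def idem_def)
  have "\<not> is_unit (e1 - e2)"
  proof
    assume "is_unit (e1 - e2)"
    then obtain y where "(e1 - e2) * y = 1" by (auto simp: is_unit_def)
    moreover have "(1 - (e1 + e2)) * (e1 - e2) = 0" using e ee by (simp add: algebra_simps)
    ultimately have "1 - (e1 + e2) = 0" by (metis mult.assoc mult.right_neutral mult_zero_left)
    then show False using ne by simp
  qed
  then obtain q f where "nilp q" "idem f" "e1 - e2 = q + f \<or> e1 - e2 = q - f"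
    using GWNC unfolding GWNC_def by blast
  moreover have "e2 - e1 = - q + f" if "e1 - e2 = q - f"
    using arg_cong[OF that, of uminus] by simp
  ultimately show False
    using difference_not_nil_clean[of e1 e2] difference_not_nil_clean[of e2 e1] e nilp_minus by metis
qed

end

section \<open>Identification of the semisimple quotient\<close>

context gwnc_semisimple_ring
begin

text \<open>A nonzero \<open>u\<close> in \<open>e1 S e2\<close> has a partner \<open>v\<close> with
  \<open>u * v = e1\<close> and \<open>v * u = e2\<close>, so \<open>e1\<close>, \<open>u\<close>,
  \<open>v\<close>, \<open>e2\<close> are matrix units over the corner of \<open>e1\<close>, a field
  with three elements.\<close>

lemma quot_iso_M2:
  fixes e1 e2 x :: 'a
  assumes e: "primitive e1" "primitive e2" "e1 + e1 + e1 = 0" "e1 * e2 = 0" "e2 * e1 = 0" "e1 + e2 = 1"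
    and x: "e1 * x * e2 \<noteq> 0"
  shows "quot_iso {0 :: 'a} (+) (**) (mat 1 :: 3^2^2) 0"
proof -
  have ee: "e1 * e1 = e1" "e2 * e2 = e2" using e by (simp_all add: primitive_def idem_def)
  define u where "u = e1 * x * e2"
  obtain y where y: "y * u = e2" "e2 * y = y"
    using primitive_left_inverse[OF e(2), of u] x ee unfolding u_def by (metis mult.assoc)
  define v where "v = y * e1"
  have u: "e1 * u = u" unfolding u_def using ee by (metis mult.assoc)
  have v: "v * e1 = v" "e2 * v = v" unfolding v_def using ee y by (metis mult.assoc)+
  have e1v: "e1 * v = 0" using v e(4) by (metis mult.assoc mult_zero_left)
  have "u * e2 = u" unfolding u_def using ee by (metis mult.assoc)
  then have ue1: "u * e1 = 0" using e(5) by (metis mult.assoc mult_zero_right)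
  have vu: "v * u = e2" unfolding v_def using y u by (metis mult.assoc)
  have "u * v * (u * v) = u * v" using vu v by (metis mult.assoc)
  moreover have "e1 * (u * v) = u * v" "u * v * e1 = u * v" using u v by (metis mult.assoc)+
  moreover have "u * v \<noteq> 0"
  proof
    assume "u * v = 0"
    then have "v * (u * v) * u = 0" by simp
    then have "e2 = 0" using vu ee by (metis mult.assoc)
    then show False using e by (simp add: primitive_def)
  qed
  ultimately have uv: "u * v = e1" using e(1) unfolding primitive_def idem_def by blast
  \<comment> \<open>These are dual bases: \<open>\<alpha> i * \<beta> j\<close> is \<open>e1\<close>
    or 0, and the \<open>\<beta> i * \<alpha> i\<close> sum to 1. Hence
    \<open>\<alpha> i * z * \<beta> j\<close> is the matrix entry of \<open>z\<close>.\<close>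
  define \<alpha> :: "2 \<Rightarrow> 'a" where "\<alpha> i = (if i = 1 then e1 else u)" for i
  define \<beta> :: "2 \<Rightarrow> 'a" where "\<beta> i = (if i = 1 then e1 else v)" for i
  have \<alpha>: "e1 * \<alpha> i = \<alpha> i" for i by (simp add: \<alpha>_def ee u)
  have \<beta>: "\<beta> i * e1 = \<beta> i" for i by (simp add: \<beta>_def ee v)
  have \<alpha>\<beta>: "\<alpha> i * \<beta> j = (if i = j then e1 else 0)" for i j
    using exhaust_2[of i] exhaust_2[of j] by (auto simp: \<alpha>_def \<beta>_def ee uv ue1 e1v)
  have \<beta>\<alpha>: "(\<Sum>i\<in>UNIV. \<beta> i * \<alpha> i) = 1"
    by (simp add: sum_2 \<alpha>_def \<beta>_def ee vu e)
  have cor: "e1 * (\<alpha> i * z * \<beta> j) = \<alpha> i * z * \<beta> j" "\<alpha> i * z * \<beta> j * e1 = \<alpha> i * z * \<beta> j" for i j z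
    using \<alpha> \<beta> by (metis mult.assoc)+
  define f where "f z = ((\<chi> i j. coeff3 e1 (\<alpha> i * z * \<beta> j)) :: 3^2^2)" for z
  have "f (z + w) = f z + f w" for z w
    by (simp add: f_def vec_eq_iff distrib_left distrib_right coeff3_add[OF e(1,3)] cor)
  moreover have "f (z * w) = f z ** f w" for z w
  proof -
    have "coeff3 e1 (\<alpha> i * (z * w) * \<beta> j)
      = (\<Sum>k\<in>UNIV. coeff3 e1 (\<alpha> i * z * \<beta> k) * coeff3 e1 (\<alpha> k * w * \<beta> j))" for i j
    proof -
      have "\<alpha> i * (z * w) * \<beta> j = \<alpha> i * z * (\<Sum>k\<in>UNIV. \<beta> k * \<alpha> k) * (w * \<beta> j)"
        unfolding \<beta>\<alpha> by (simp add: mult.assoc)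
      also have "\<dots> = (\<Sum>k\<in>UNIV. (\<alpha> i * z * \<beta> k) * (\<alpha> k * w * \<beta> j))"
        by (simp add: sum_distrib_left sum_distrib_right mult.assoc)
      finally have eq: "\<alpha> i * (z * w) * \<beta> j = (\<Sum>k\<in>UNIV. (\<alpha> i * z * \<beta> k) * (\<alpha> k * w * \<beta> j))" .
      have "e1 * ((\<alpha> i * z * \<beta> k) * (\<alpha> k * w * \<beta> j)) = (\<alpha> i * z * \<beta> k) * (\<alpha> k * w * \<beta> j)"
        "(\<alpha> i * z * \<beta> k) * (\<alpha> k * w * \<beta> j) * e1 = (\<alpha> i * z * \<beta> k) * (\<alpha> k * w * \<beta> j)" for k
        using cor by (metis mult.assoc)+
      then show ?thesis unfolding eq
        by (subst coeff3_sum[OF e(1,3)]) (simp_all add: coeff3_mult[OF e(1,3)] cor)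
    qed
    then show ?thesis by (simp add: f_def vec_eq_iff matrix_matrix_mult_def)
  qed
  moreover have "f 1 = mat 1"
    using e(1) by (auto simp: f_def vec_eq_iff mat_def \<alpha>\<beta> coeff3_def primitive_def)
  moreover have "surj f"
  proof (rule surjI)
    fix A :: "3^2^2"
    define z where "z = (\<Sum>k\<in>UNIV. \<Sum>l\<in>UNIV. \<beta> k * scale3 (A $ k $ l) e1 * \<alpha> l)"
    have sc: "e1 * scale3 k e1 = scale3 k e1" "scale3 k e1 * e1 = scale3 k e1" for k
      using ee by (simp_all add: scale3_def)
    have "\<alpha> i * z * \<beta> j = (\<Sum>k\<in>UNIV. \<Sum>l\<in>UNIV. (\<alpha> i * \<beta> k) * scale3 (A $ k $ l) e1 * (\<alpha> l * \<beta> j))" for i j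
      by (simp add: z_def sum_distrib_left sum_distrib_right mult.assoc)
    also have "\<dots> i j = (\<Sum>k\<in>UNIV. \<Sum>l\<in>UNIV. if i = k then if l = j then scale3 (A $ k $ l) e1 else 0 else 0)" for i j
      by (intro sum.cong refl) (simp add: \<alpha>\<beta> sc)
    also have "\<dots> i j = scale3 (A $ i $ j) e1" for i j
      using exhaust_2[of i] exhaust_2[of j] by (auto simp: sum_2)
    finally show "f z = A" by (simp add: f_def vec_eq_iff coeff3_scale3[OF e(1,3)])
  qed
  moreover have "f z = 0 \<longleftrightarrow> z = 0" for z
  proof
    assume "f z = 0"
    then have "coeff3 e1 (\<alpha> i * z * \<beta> j) = 0" for i j by (simp add: f_def vec_eq_iff)
    then have z: "\<alpha> i * z * \<beta> j = 0" for i j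
      using scale3_coeff3[OF e(1) cor] by (metis scale3_simps(1))
    have "z = (\<Sum>i\<in>UNIV. \<beta> i * \<alpha> i) * z * (\<Sum>j\<in>UNIV. \<beta> j * \<alpha> j)" unfolding \<beta>\<alpha> by simp
    also have "\<dots> = (\<Sum>i\<in>UNIV. \<Sum>j\<in>UNIV. \<beta> i * (\<alpha> i * z * \<beta> j) * \<alpha> j)"
      by (simp only: sum_distrib_right sum_distrib_left mult.assoc) (rule sum.swap)
    finally show "z = 0" by (simp add: z)
  qed (simp add: f_def vec_eq_iff coeff3_def)
  ultimately show ?thesis unfolding quot_iso_def by blast
qed

text \<open>With both off-diagonal corners zero, the ring is the product of its two diagonal
  corners, each a field with three elements.\<close>

lemma quot_iso_product:
  fixes e1 e2 :: 'a
  assumes e: "primitive e1" "primitive e2" "e1 + e1 + e1 = 0" "e2 + e2 + e2 = 0" "e1 + e2 = 1"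
    and x: "\<And>x. e1 * x * e2 = 0" "\<And>x. e2 * x * e1 = 0"
  shows "quot_iso {0 :: 'a} (\<lambda>(a,b) (c,d). (a + c, b + d)) (\<lambda>(a,b) (c,d). (a * c, b * d)) ((1::3), (1::3)) (0, 0)"
proof -
  have ee: "e1 * e1 = e1" "e2 * e2 = e2" using e by (simp_all add: primitive_def idem_def)
  have e0: "e1 \<noteq> 0" "e2 \<noteq> 0" using e by (simp_all add: primitive_def)
  have e12: "e1 * e2 = 0" "e2 * e1 = 0" using x[of 1] by simp_all
  have cor: "e1 * (e1 * z * e1) = e1 * z * e1" "e1 * z * e1 * e1 = e1 * z * e1"
    "e2 * (e2 * z * e2) = e2 * z * e2" "e2 * z * e2 * e2 = e2 * z * e2" for z
    using ee by (metis mult.assoc)+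
  define f where "f z = (coeff3 e1 (e1 * z * e1), coeff3 e2 (e2 * z * e2))" for z
  have "f (z + w) = (\<lambda>(a,b) (c,d). (a + c, b + d)) (f z) (f w)" for z w
    by (simp add: f_def distrib_left distrib_right coeff3_add[OF e(1,3)] coeff3_add[OF e(2,4)] cor)
  moreover have "f (z * w) = (\<lambda>(a,b) (c,d). (a * c, b * d)) (f z) (f w)" for z w
  proof -
    have "z * w = z * (e1 + e2) * w" using e by simp
    also have "\<dots> = z * (e1 * (e1 * w)) + z * (e2 * (e2 * w))"
      using ee by (simp add: distrib_left distrib_right mult.assoc mult_absorb_left[OF ee(1)] mult_absorb_left[OF ee(2)])
    finally have zw: "z * w = z * (e1 * (e1 * w)) + z * (e2 * (e2 * w))" .
    have "e1 * (z * w) * e1 = (e1 * z * e1) * (e1 * w * e1) + (e1 * z * e2) * (e2 * w * e1)"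
      "e2 * (z * w) * e2 = (e2 * z * e1) * (e1 * w * e2) + (e2 * z * e2) * (e2 * w * e2)"
      unfolding zw by (simp_all add: distrib_left distrib_right mult.assoc)
    then have "e1 * (z * w) * e1 = (e1 * z * e1) * (e1 * w * e1)"
      "e2 * (z * w) * e2 = (e2 * z * e2) * (e2 * w * e2)"
      unfolding x by simp_all
    then show ?thesis
      by (simp add: f_def coeff3_mult[OF e(1,3)] coeff3_mult[OF e(2,4)] cor)
  qed
  moreover have "f 1 = (1, 1)" using ee e0 by (simp add: f_def coeff3_def)
  moreover have "surj f"
  proof (rule surjI)
    fix p :: "3 \<times> 3"
    have "e1 * (scale3 (fst p) e1 + scale3 (snd p) e2) * e1 = scale3 (fst p) e1"
      "e2 * (scale3 (fst p) e1 + scale3 (snd p) e2) * e2 = scale3 (snd p) e2"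
      using ee e12 by (auto simp: scale3_def distrib_left distrib_right)
    then show "f (scale3 (fst p) e1 + scale3 (snd p) e2) = p"
      by (simp add: f_def coeff3_scale3[OF e(1,3)] coeff3_scale3[OF e(2,4)])
  qed
  moreover have "f z = (0, 0) \<longleftrightarrow> z = 0" for z
  proof
    assume "f z = (0, 0)"
    then have "coeff3 e1 (e1 * z * e1) = 0" "coeff3 e2 (e2 * z * e2) = 0" by (simp_all add: f_def)
    then have "e1 * z * e1 = 0" "e2 * z * e2 = 0"
      using scale3_coeff3[OF e(1) cor(1,2)] scale3_coeff3[OF e(2) cor(3,4)]
      by (metis scale3_simps(1))+
    then have "(e1 + e2) * z * (e1 + e2) = 0" using x by (simp add: distrib_left distrib_right)
    then show "z = 0" using e by simp
  qed (simp add: f_def coeff3_def)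
  ultimately show ?thesis unfolding quot_iso_def by blast
qed

text \<open>From \<open>6 = 0\<close> one gets \<open>9 = 3\<close>, \<open>16 = 4\<close>,
  \<open>12 = 0\<close> and \<open>7 = 1\<close>, so 3 and 4 are complementary central idempotents.
  The component \<open>3 * x\<close> lives in characteristic 2 and is nil-clean;
  \<open>4 * x\<close> is 0, 4 or -4, and the last value is removed by replacing \<open>x\<close> by
  \<open>- x\<close>.\<close>

lemma weakly_nil_clean_if:
  assumes four: "(4 :: 'a) = 0 \<or> primitive (4 :: 'a)"
  shows "weakly_nil_clean TYPE('a)"
proof -
  have six: "(6 :: 'a) = 0" by (rule six_eq_zero)
  have "(12 :: 'a) = 2 * 6" "(7 :: 'a) = 1 + 6" "(9 :: 'a) = 3 + 6" "(16 :: 'a) = 4 + 2 * 6" by simp_all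
  then have n: "(12 :: 'a) = 0" "(7 :: 'a) = 1" "(9 :: 'a) = 3" "(16 :: 'a) = 4"
    unfolding six by simp_all
  have split: "x = 3 * x + 4 * x" for x :: 'a
    using n(2) by (simp flip: distrib_right)
  have clean: "\<exists>e. idem e \<and> nilp (x - e)" if x4: "4 * x = 0 \<or> 4 * x = 4" for x :: 'a
  proof -
    have "3 * (3 * x) = 3 * x" using n by (simp flip: mult.assoc)
    moreover have "3 * x * 3 = 3 * x" using n numeral_commute by (metis calculation)
    ultimately obtain f where f: "idem f" "nilp (3 * x - f)" "3 * f = f" "f * 3 = f"
      using nil_clean_corner[of 3 "3 * x"] n six by (auto simp: idem_def)
    have "4 * f = 4 * (3 * f)" using f by simp
    also have "\<dots> = 12 * f" by (simp flip: mult.assoc)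
    finally have f4: "4 * f = 0" "f * 4 = 0" using n numeral_commute by (metis mult_zero_left)+
    \<comment> \<open>The component \<open>4 * x\<close> is itself idempotent here, so it is added
      to the orthogonal \<open>f\<close> and leaves the nilpotent part unchanged.\<close>
    have "idem (f + 4 * x)"
      using x4 f(1) f4 n by (auto simp: idem_def distrib_left distrib_right)
    moreover have "x - (f + 4 * x) = 3 * x - f" using split[of x] by (simp add: algebra_simps)
    ultimately show ?thesis using f(2) by metis
  qed
  have "4 * x = 0 \<or> 4 * x = 4 \<or> 4 * x = - 4" for x :: 'a
  proof (cases "(4 :: 'a) = 0")
    case False
    have "4 * (4 * x) = 4 * x" using n by (simp flip: mult.assoc)
    moreover have "4 * x * 4 = 4 * (4 * x)" by (rule numeral_commute[symmetric])
    ultimately have "4 * (4 * x) = 4 * x" "4 * x * 4 = 4 * x" by simp_all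
    then show ?thesis using primitive_corner[of 4 "4 * x"] four False by blast
  qed simp
  then have "(4 * x = 0 \<or> 4 * x = 4) \<or> (4 * (- x) = 0 \<or> 4 * (- x) = 4)" for x :: 'a by fastforce
  then have *: "(\<exists>e. idem e \<and> nilp (x - e)) \<or> (\<exists>e. idem e \<and> nilp (- x - e))" for x :: 'a
    using clean[of x] clean[of "- x"] by blast
  have "- x - e = - (x + e)" for x e :: 'a by simp
  then have "\<exists>e. idem e \<and> (nilp (x - e) \<or> nilp (x + e))" for x :: 'a
    using *[of x] nilp_minus by metis
  then show ?thesis by (simp add: weakly_nil_clean_def)
qed

theorem classification:
  "quot_iso {0 :: 'a} (+) (**) (mat 1 :: 3^2^2) 0
   \<or> quot_iso {0 :: 'a} (\<lambda>(a,b) (c,d). (a + c, b + d)) (\<lambda>(a,b) (c,d). (a * c, b * d)) ((1::3), (1::3)) (0, 0)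
   \<or> weakly_nil_clean TYPE('a)"
proof -
  have six: "(6 :: 'a) = 0" by (rule six_eq_zero)
  have "(12 :: 'a) = 2 * 6" "(16 :: 'a) = 4 + 2 * 6" by simp_all
  then have n: "(12 :: 'a) = 0" "(16 :: 'a) = 4" unfolding six by simp_all
  obtain E :: "'a set" where E: "finite E" "\<And>e. e \<in> E \<Longrightarrow> primitive e \<and> 4 * e = e \<and> e * 4 = e"
    "pairwise (\<lambda>e e'. e * e' = 0) E" "\<Sum>E = 4"
    using primitive_decomposition[of 4] n by (auto simp: idem_def)
  interpret char3_part T E 4
  proof
    show "4 * x = x * 4" for x :: 'a by (rule numeral_commute)
    show "e * e' = 0" if "e \<in> E" "e' \<in> E" "e \<noteq> e'" for e e'
      using E(3) that by (auto simp: pairwise_def)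
  qed (use E n in auto)
  show ?thesis
  proof (cases "\<exists>e1\<in>E. \<exists>e2\<in>E. e1 \<noteq> e2")
    case True
    then obtain e1 e2 where e: "e1 \<in> E" "e2 \<in> E" "e1 \<noteq> e2" by blast
    have orth: "e1 * e2 = 0" "e2 * e1 = 0" using orthogonal_E e by auto
    have one: "e1 + e2 = 1" using two_primitives[of e1 e2] primitive_E e d_E orth by blast
    \<comment> \<open>The two primitives are equivalent, which gives matrix units, unless both
      off-diagonal corners vanish.\<close>
    consider x where "e1 * x * e2 \<noteq> 0" | x where "e2 * x * e1 \<noteq> 0"
      | "\<And>x. e1 * x * e2 = 0" "\<And>x. e2 * x * e1 = 0" by blast
    then show ?thesis
    proof cases
      case (1 x)
      then show ?thesis using quot_iso_M2[OF _ _ _ orth one 1] primitive_E torsion_E e by blast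
    next
      case (2 x)
      have "e2 + e1 = 1" using one by (simp add: add.commute)
      then show ?thesis using quot_iso_M2[OF _ _ _ orth(2,1) _ 2] primitive_E torsion_E e by blast
    next
      case 3
      then show ?thesis using quot_iso_product[OF _ _ _ _ one] primitive_E torsion_E e by blast
    qed
  next
    case False
    then have "E = {} \<or> (\<exists>e. E = {e})" by blast
    then have "(4 :: 'a) = 0 \<or> primitive (4 :: 'a)"
    proof
      assume "E = {}"
      then show ?thesis using sum_E by simp
    next
      assume "\<exists>e. E = {e}"
      then obtain e where "E = {e}" ..
      then have "e = 4" "primitive e" using sum_E primitive_E by simp_all
      then show ?thesis by simp
    qed
    then show ?thesis using weakly_nil_clean_if by blast
  qed
qed

end

subsection \<open>The quotient by the Jacobson radical\<close>

lemma equivp_jac: "equivp (\<lambda>x y. x - y \<in> (jac :: 'a::ring_1 set))"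
proof (rule equivpI)
  show "reflp (\<lambda>x y. x - y \<in> (jac :: 'a set))" by (simp add: reflp_def jac_simps)
  show "symp (\<lambda>x y. x - y \<in> (jac :: 'a set))"
    using jac_simps(4) by (fastforce simp: symp_def)
  show "transp (\<lambda>x y. x - y \<in> (jac :: 'a set))"
    unfolding transp_def using jac_simps(2) by (metis diff_add_cancel add_diff_eq)
qed

quotient_type (overloaded) 'a jac_quotient = "'a::ring_1" / "\<lambda>x y. x - y \<in> jac"
  by (rule equivp_jac)

instantiation jac_quotient :: (ring_1) ring_1
begin

lift_definition zero_jac_quotient :: "'a jac_quotient" is 0 .
lift_definition one_jac_quotient :: "'a jac_quotient" is 1 .
lift_definition plus_jac_quotient :: "'a jac_quotient \<Rightarrow> 'a jac_quotient \<Rightarrow> 'a jac_quotient" is "(+)"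
  by (metis add_diff_add jac_simps(2))
lift_definition uminus_jac_quotient :: "'a jac_quotient \<Rightarrow> 'a jac_quotient" is uminus
  by (metis jac_simps(4) minus_diff_minus)
lift_definition minus_jac_quotient :: "'a jac_quotient \<Rightarrow> 'a jac_quotient \<Rightarrow> 'a jac_quotient" is "(-)"
proof -
  fix a b c d :: 'a assume "a - b \<in> jac" "c - d \<in> jac"
  then have "(a - b) - (c - d) \<in> jac" by (rule jac_simps(5))
  then show "a - c - (b - d) \<in> jac" by (simp add: algebra_simps)
qed
lift_definition times_jac_quotient :: "'a jac_quotient \<Rightarrow> 'a jac_quotient \<Rightarrow> 'a jac_quotient" is "(*)"
proof -
  fix a b c d :: 'a assume "a - b \<in> jac" "c - d \<in> jac"
  then have "(a - b) * c + b * (c - d) \<in> jac" 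
    by (rule jac_simps(2)[OF jac_simps(6) jac_simps(3)])
  then show "a * c - b * d \<in> jac" by (simp add: algebra_simps)
qed

instance
proof
  show "(0 :: 'a jac_quotient) \<noteq> 1"
    by transfer (metis diff_0 jac_simps(4) minus_minus one_notin_jac)
qed (transfer; simp add: algebra_simps jac_simps)+

end

lift_definition jac_proj :: "'a::ring_1 \<Rightarrow> 'a jac_quotient" is "\<lambda>x. x" .

lemma jac_proj_eq_0_iff: "jac_proj x = 0 \<longleftrightarrow> x \<in> jac"
  by transfer simp

lemma jac_proj_hom:
  "jac_proj (x + y) = jac_proj x + jac_proj y" "jac_proj (x - y) = jac_proj x - jac_proj y"
  "jac_proj (x * y) = jac_proj x * jac_proj y" "jac_proj 0 = 0" "jac_proj 1 = 1"
  by (transfer, simp add: jac_simps)+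

lemma jac_proj_power: "jac_proj (x ^ n) = jac_proj x ^ n"
  by (induction n) (simp_all add: jac_proj_hom)

lemma jac_proj_eq_iff: "jac_proj x = jac_proj y \<longleftrightarrow> x - y \<in> jac"
  by transfer simp

lemma surj_jac_proj: obtains x where "jac_proj x = y"
  by (induction y) (auto simp: jac_proj.abs_eq)

text \<open>A left ideal is pulled back to one containing \<open>J\<close>, complemented there, and
  the complement is pushed forward; the two meet in \<open>J\<close>, which becomes 0.\<close>

lemma semisimple_jac_quotient:
  assumes "semilocal TYPE('a::ring_1)"
  shows "semisimple_ring TYPE('a jac_quotient)"
proof
  fix L :: "'a jac_quotient set" assume L: "left_ideal L"
  define M where "M = {x. jac_proj x \<in> L}"
  have "left_ideal M" using left_idealD[OF L] unfolding M_def left_ideal_def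
    by (simp add: jac_proj_hom)
  moreover have "jac \<subseteq> M" using left_idealD(1)[OF L] by (auto simp: M_def simp flip: jac_proj_eq_0_iff)
  ultimately have "\<exists>M'. left_ideal M' \<and> jac \<subseteq> M' \<and> {x + y |x y. x \<in> M \<and> y \<in> M'} = UNIV \<and> M \<inter> M' = jac"
    using assms unfolding semilocal_def by simp
  then obtain M' where M': "left_ideal M'" "jac \<subseteq> M'"
    "{x + y |x y. x \<in> M \<and> y \<in> M'} = UNIV" "M \<inter> M' = jac"
    by (elim exE conjE)
  define L' where "L' = jac_proj ` M'"
  have "left_ideal L'" unfolding left_ideal_def
  proof (intro conjI ballI allI)
    show "0 \<in> L'" unfolding L'_def using left_idealD(1)[OF M'(1)] by (metis image_eqI jac_proj_hom(4))
  next
    fix x y assume "x \<in> L'" "y \<in> L'"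
    then show "x + y \<in> L'" unfolding L'_def using left_idealD(2)[OF M'(1)]
      by (auto simp flip: jac_proj_hom(1))
  next
    fix r x :: "'a jac_quotient" assume "x \<in> L'"
    moreover obtain s where "r = jac_proj s" using surj_jac_proj by metis
    ultimately show "r * x \<in> L'" unfolding L'_def using left_idealD(3)[OF M'(1)]
      by (auto simp flip: jac_proj_hom(3))
  qed
  moreover have "{x + y |x y. x \<in> L \<and> y \<in> L'} = UNIV"
  proof (intro set_eqI iffI UNIV_I)
    fix z :: "'a jac_quotient"
    obtain w where w: "z = jac_proj w" using surj_jac_proj by metis
    have "w \<in> {x + y |x y. x \<in> M \<and> y \<in> M'}" using M'(3) by simp
    then obtain x y where "w = x + y" "x \<in> M" "y \<in> M'" by blast
    then have "z = jac_proj x + jac_proj y" "jac_proj x \<in> L" "jac_proj y \<in> L'"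
      by (simp_all add: w jac_proj_hom M_def L'_def)
    then show "z \<in> {x + y |x y. x \<in> L \<and> y \<in> L'}" by blast
  qed
  moreover have "L \<inter> L' = {0}"
  proof
    show "L \<inter> L' \<subseteq> {0}"
    proof
      fix z assume "z \<in> L \<inter> L'"
      then obtain y where "z = jac_proj y" "y \<in> M'" "y \<in> M" by (auto simp: L'_def M_def)
      then show "z \<in> {0}" using M'(4) by (auto simp: jac_proj_eq_0_iff)
    qed
  qed (use left_idealD(1)[OF L] left_idealD(1)[OF \<open>left_ideal L'\<close>] in simp)
  ultimately show "\<exists>L'. left_ideal L' \<and> {x + y |x y. x \<in> L \<and> y \<in> L'} = UNIV \<and> L \<inter> L' = {0}"
    by (intro exI[of _ L'] conjI)
qed

lemma GWNC_jac_quotient: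
  assumes "GWNC TYPE('a::ring_1)" shows "GWNC TYPE('a jac_quotient)"
  unfolding GWNC_def
proof (intro allI impI)
  fix a :: "'a jac_quotient" assume nu: "\<not> is_unit a"
  obtain b where b: "a = jac_proj b" using surj_jac_proj by metis
  have "\<not> is_unit b"
  proof
    assume "is_unit b"
    then obtain c where "b * c = 1" "c * b = 1" by (auto simp: is_unit_def)
    then have "a * jac_proj c = 1" "jac_proj c * a = 1" unfolding b by (simp_all flip: jac_proj_hom)
    then show False using nu by (auto simp: is_unit_def)
  qed
  then obtain q e where qe: "nilp q" "idem e" "b = q + e \<or> b = q - e"
    using assms unfolding GWNC_def by blast
  have "nilp (jac_proj q)" using qe(1) unfolding nilp_def
    by (metis jac_proj_hom(4) jac_proj_power)
  moreover have "idem (jac_proj e)" using qe(2) by (simp add: idem_def flip: jac_proj_hom)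
  moreover have "a = jac_proj q + jac_proj e \<or> a = jac_proj q - jac_proj e"
    using qe(3) by (auto simp: b jac_proj_hom)
  ultimately show "\<exists>q e. nilp q \<and> idem e \<and> (a = q + e \<or> a = q - e)" by blast
qed

lemma quot_iso_jac_quotient:
  assumes "quot_iso {0 :: 'a::ring_1 jac_quotient} pl ml un z"
  shows "quot_iso (jac :: 'a set) pl ml un z"
proof -
  obtain f :: "'a jac_quotient \<Rightarrow> 'b" where f: "\<And>x y. f (x + y) = pl (f x) (f y)" "\<And>x y. f (x * y) = ml (f x) (f y)"
    "f 1 = un" "surj f" "{x. f x = z} = {0}"
    using assms unfolding quot_iso_def by (elim exE conjE) blast
  have "f x = z \<longleftrightarrow> x = 0" for x using f(5) by blast
  then have "{x. (f \<circ> jac_proj) x = z} = jac" by (simp add: jac_proj_eq_0_iff)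
  moreover have "surj (f \<circ> jac_proj)"
    using f(4) surj_jac_proj by (metis comp_apply surj_def)
  ultimately show ?thesis unfolding quot_iso_def
    by (intro exI[of _ "f \<circ> jac_proj"]) (simp add: f jac_proj_hom)
qed

text \<open>Idempotents lift modulo the nil ideal \<open>J\<close>, and an element that is nilpotent
  modulo \<open>J\<close> is nilpotent.\<close>

lemma weakly_nil_clean_jac_quotient:
  assumes "weakly_nil_clean TYPE('a::ring_1 jac_quotient)" and nil: "nil_set (jac :: 'a set)"
  shows "weakly_nil_clean TYPE('a)"
  unfolding weakly_nil_clean_def
proof
  fix a :: 'a
  obtain e where e: "idem e" "nilp (jac_proj a - e) \<or> nilp (jac_proj a + e)"
    using assms(1) unfolding weakly_nil_clean_def by blast
  obtain x where x: "e = jac_proj x" using surj_jac_proj by metis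
  have "x * x - x \<in> jac" using e(1) by (simp add: idem_def x jac_proj_hom flip: jac_proj_eq_0_iff)
  then obtain e' where e': "idem e'" "e' - x \<in> jac" using idempotent_lift nil by blast
  then have "e = jac_proj e'" using x jac_proj_eq_iff by metis
  then have "nilp (jac_proj (a - e')) \<or> nilp (jac_proj (a + e'))"
    using e(2) by (simp add: jac_proj_hom)
  moreover have "nilp y" if "nilp (jac_proj y)" for y :: 'a
    using that nilp_mod_jac[OF nil] unfolding nilp_def[of "jac_proj y"]
    by (auto simp: jac_proj_eq_0_iff simp flip: jac_proj_power)
  ultimately show "\<exists>e. idem e \<and> (nilp (a - e) \<or> nilp (a + e))" using e'(1) by blast
qed

section \<open>The division ring case and the final equivalence\<close>

lemma (in semisimple_ring) unit_if_primitive_one: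
  assumes "primitive (1 :: 'a)" "x \<noteq> (0 :: 'a)"
  shows "is_unit x"
proof -
  obtain y where "y * x = 1"
    by (rule primitive_left_inverse[OF assms(1) _ assms(2)]) simp_all
  moreover obtain z where "x * z = 1"
    by (rule primitive_right_inverse[OF assms(1) _ assms(2)]) simp_all
  ultimately show ?thesis unfolding is_unit_def by (metis mult.assoc mult_1 mult.right_neutral)
qed

theorem theorem2p38:
  assumes "semilocal TYPE('a::ring_1)"
  shows "GWNC TYPE('a) \<longleftrightarrow>
    ((local_ring TYPE('a) \<and> nil_set (jac :: 'a set))
     \<or> (quot_M2Z3 TYPE('a) \<and> nil_set (jac :: 'a set))
     \<or> (quot_Z3Z3 TYPE('a) \<and> nil_set (jac :: 'a set))
     \<or> weakly_nil_clean TYPE('a))"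
proof
  assume G: "GWNC TYPE('a)"
  have nil: "nil_set (jac :: 'a set)" by (rule GWNC_jac_nil[OF G])
  interpret S: semisimple_ring "TYPE('a jac_quotient)" by (rule semisimple_jac_quotient[OF assms])
  show "(local_ring TYPE('a) \<and> nil_set (jac :: 'a set))
     \<or> (quot_M2Z3 TYPE('a) \<and> nil_set (jac :: 'a set))
     \<or> (quot_Z3Z3 TYPE('a) \<and> nil_set (jac :: 'a set))
     \<or> weakly_nil_clean TYPE('a)"
  \<comment> \<open>Primitivity of 1 in the quotient is the local case; otherwise the classification
    applies and is carried back along \<open>jac_proj\<close>.\<close>
  proof (cases "primitive (1 :: 'a jac_quotient)")
    case True
    have "\<exists>y. x * y - 1 \<in> jac \<and> y * x - 1 \<in> jac" if "x \<notin> jac" for x :: 'a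
    proof -
      have "is_unit (jac_proj x)"
        using S.unit_if_primitive_one[OF True] that by (simp add: jac_proj_eq_0_iff)
      then obtain y where y: "jac_proj x * y = 1" "y * jac_proj x = 1" by (auto simp: is_unit_def)
      obtain z where "y = jac_proj z" using surj_jac_proj by metis
      then show ?thesis using y
        by (intro exI[of _ z]) (simp add: jac_proj_hom flip: jac_proj_eq_0_iff)
    qed
    then have "local_ring TYPE('a)" by (simp add: local_ring_def one_notin_jac)
    then show ?thesis using nil by blast
  next
    case False
    interpret S: gwnc_semisimple_ring "TYPE('a jac_quotient)"
      by unfold_locales (rule GWNC_jac_quotient[OF G], rule False)
    from S.classification show ?thesis
      unfolding quot_M2Z3_def quot_Z3Z3_def
      by (elim disjE) (simp_all add: quot_iso_jac_quotient weakly_nil_clean_jac_quotient nil)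
  qed
next
  assume "(local_ring TYPE('a) \<and> nil_set (jac :: 'a set))
     \<or> (quot_M2Z3 TYPE('a) \<and> nil_set (jac :: 'a set))
     \<or> (quot_Z3Z3 TYPE('a) \<and> nil_set (jac :: 'a set))
     \<or> weakly_nil_clean TYPE('a)"
  then show "GWNC TYPE('a)"
    by (elim disjE conjE) (simp_all add: local_imp_GWNC quot_M2Z3_imp_GWNC quot_Z3Z3_imp_GWNC
      weakly_nil_clean_imp_GWNC)
qed

end
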